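(* Let $W=W_{D_n}$ and let $V$ be a $\mathbb CW^-$-module. The action of $\xi_i$ on the $\ddot{\mathfrak H}^-_W$-module $\mathbb C[y_1,\dots,y_n]\otimes V$ is realized as a Dunkl operator as follows. For any polynomial $f\in\mathbb C[y_1,\dots,y_n]$ and $v\in V$, $$\xi_i\circ(f\otimes v)=u\sum_{k\ne i}\frac{f-f^{s_{ki}}}{y_i-y_k}\otimes[k,i]\,v-u\sum_{k\ne i}\frac{f-f^{\overline{s}_{ki}}}{y_i+y_k}\otimes\overline{[k,i]}\,v .$$
   Context: Ground field $\mathbb C$, $u\in\mathbb C$. $W=W_{D_n}$ ($n\ge4$) is the group of signed permutations of $y_1,\dots,y_n$ with an even number of sign changes. For $i\ne j$: $s_{ij}$ swaps $y_i,y_j$; $\overline{s}_{ij}$ sends $y_i\mapsto-y_j$, $y_j\mapsto-y_i$ (other $y_k$ fixed). $s_i=s_{i,i+1}$ for $i\le n-1$, $s_n=\overline{s}_{n-1,n}$. $f^\sigma$ denotes the induced action of $\sigma\in W$ on $f\in\mathbb C[y_1,\dots,y_n]$. The spin Weyl group algebra $\mathbb CW^-$ of type $D_n$ is generated by $t_1,\dots,t_n$ with $t_i^2=1$ (all $i$); $t_it_{i+1}t_i=t_{i+1}t_it_{i+1}$ ($1\le i\le n-2$); $(t_it_j)^2=-1$ for $i,j\le n-1$, $|i-j|>1$; $(t_it_n)^2=-1$ for $i\ne n-2,n$; $t_{n-2}t_nt_{n-2}=t_nt_{n-2}t_n$. Put $t_{i\uparrow j}=t_it_{i+1}\cdots t_j$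 if $i\le j$, $1$ otherwise; $t_{i\downarrow j}=t_it_{i-1}\cdots t_j$ if $i\ge j$, $1$ otherwise. For $1\le i<j\le n$: $[i,j]=(-1)^{j-i-1}t_{j-1}\cdots t_{i+1}t_it_{i+1}\cdots t_{j-1}$, $[j,i]=-[i,j]$; $\overline{[i,j]}=\overline{[j,i]}=(-1)^{j-i-1}t_{j\uparrow n-1}t_{i\uparrow n-2}\,t_n\,t_{n-2\downarrow i}t_{n-1\downarrow j}$. The rational spin double affine Hecke algebra $\ddot{\mathfrak H}^-_W$ of type $D_n$ is generated by $\xi_i,y_i$ ($1\le i\le n$) and $\mathbb CW^-$, subject to: $y_iy_j=y_jy_i$; $\xi_i\xi_j=-\xi_j\xi_i$ ($i\ne j$); for $1\le i\le n-1$: $t_iy_i=y_{i+1}t_i$, $t_i\xi_i=-\xi_{i+1}t_i$, $t_iy_j=y_jt_i$, $t_i\xi_j=-\xi_jt_i$ ($j\ne i,i+1$); $t_ny_n=-y_{n-1}t_n$, $t_n\xi_n=-\xi_{n-1}t_n$, $t_ny_j=y_jt_n$, $t_n\xi_j=-\xi_jt_n$ ($j\ne n-1,n$); $y_j\xi_i-\xi_iy_j=-u[i,j]+u\overline{[i,j]}$ ($i\ne j$); $y_i\xi_i-\xi_iy_i=u\sum_{k\ne i}([i,k]+\overline{[i,k]})$. It has the triangular decomposition $\mathcal C[\xi_1,\dots,\xi_n]\otimes\mathbb CW^-\otimes\mathbb C[y_1,\dots,y_n]$, where $\mathcal C[\xi_1,\dots,\xi_n]$ is the skew-polynomial algebra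 with $\xi_i\xi_j=-\xi_j\xi_i$ ($i\ne j$). Let $\mathfrak h_\xi$ be the subalgebra generated by the $\xi_i$ and $\mathbb CW^-$. A $\mathbb CW^-$-module $V$ is extended to an $\mathfrak h_\xi$-module by letting all $\xi_i$ act by $0$, and $V_\xi=\mathrm{Ind}_{\mathfrak h_\xi}^{\ddot{\mathfrak H}^-_W}V$ is identified with $\mathbb C[y_1,\dots,y_n]\otimes V$; this is the module structure in question ($t_i$ acts as $s_i\otimes t_i$; $y_i$ acts by left multiplication; $\circ$ denotes the action). *)

theory Defs
  imports
    "HOL-Library.Poly_Mapping"
    "HOL-Algebra.Free_Abelian_Groups"
    "HOL-Algebra.Generated_Rings"
    "HOL-Algebra.QuotRing"
    "HOL-Algebra.Module"
begin

section \<open>Free associative algebras\<close>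

text \<open>
  Words form a monoid under concatenation; registering this additively makes
  \<open>'g list \<Rightarrow>\<^sub>0 complex\<close>, with its convolution product, the free associative
  \<open>\<complex>\<close>-algebra on \<open>'g\<close> (a non-commutative \<^class>\<open>ring_1\<close>).
\<close>

instantiation list :: (type) monoid_add
begin

definition zero_list_def: "0 = ([] :: 'a list)"

definition plus_list_def: "xs + ys = (xs @ ys :: 'a list)"

instance
  by standard (simp_all add: zero_list_def plus_list_def)

end

type_synonym 'g free_algebra = "'g list \<Rightarrow>\<^sub>0 complex"

abbreviation word :: "'g list \<Rightarrow> 'g free_algebra" where
  "word w \<equiv> Poly_Mapping.single w 1"

abbreviation scalar :: "complex \<Rightarrow> 'g free_algebra" where
  "scalar c \<equiv> Poly_Mapping.single [] c"

definition free_alg :: "'g set \<Rightarrow> 'g free_algebra ring" where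
  "free_alg G = \<lparr>carrier = {p. \<forall>w\<in>Poly_Mapping.keys p. set w \<subseteq> G},
                 monoid.mult = (*), one = 1, zero = 0, add = (+)\<rparr>"

text \<open>The algebra with generators \<open>G\<close> and relations \<open>r = 0\<close> for \<open>r \<in> R\<close>, and the class in it of
  a non-commutative polynomial in the generators.\<close>

definition presented :: "'g set \<Rightarrow> 'g free_algebra set \<Rightarrow> 'g free_algebra set ring" where
  "presented G R = free_alg G Quot (Idl\<^bsub>free_alg G\<^esub> R)"

definition pclass :: "'g set \<Rightarrow> 'g free_algebra set \<Rightarrow> 'g free_algebra \<Rightarrow> 'g free_algebra set" where
  "pclass G R p = (Idl\<^bsub>free_alg G\<^esub> R) +>\<^bsub>free_alg G\<^esub> p"


section \<open>Modules over non-commutative rings\<close>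

text \<open>Same axioms as the library's \<^locale>\<open>module\<close>, which assumes a commutative ring of scalars.\<close>

locale left_module = R?: ring R + M?: abelian_group M
  for R :: "('a, 'r) ring_scheme" (structure)
    and M :: "('a, 'b, 'm) module_scheme" (structure) +
  assumes smult_closed:
      "\<lbrakk>a \<in> carrier R; x \<in> carrier M\<rbrakk> \<Longrightarrow> a \<odot>\<^bsub>M\<^esub> x \<in> carrier M"
    and smult_l_distr:
      "\<lbrakk>a \<in> carrier R; b \<in> carrier R; x \<in> carrier M\<rbrakk> \<Longrightarrow>
        (a \<oplus>\<^bsub>R\<^esub> b) \<odot>\<^bsub>M\<^esub> x = a \<odot>\<^bsub>M\<^esub> x \<oplus>\<^bsub>M\<^esub> b \<odot>\<^bsub>M\<^esub> x"
    and smult_r_distr: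
      "\<lbrakk>a \<in> carrier R; x \<in> carrier M; y \<in> carrier M\<rbrakk> \<Longrightarrow>
        a \<odot>\<^bsub>M\<^esub> (x \<oplus>\<^bsub>M\<^esub> y) = a \<odot>\<^bsub>M\<^esub> x \<oplus>\<^bsub>M\<^esub> a \<odot>\<^bsub>M\<^esub> y"
    and smult_assoc:
      "\<lbrakk>a \<in> carrier R; b \<in> carrier R; x \<in> carrier M\<rbrakk> \<Longrightarrow>
        (a \<otimes>\<^bsub>R\<^esub> b) \<odot>\<^bsub>M\<^esub> x = a \<odot>\<^bsub>M\<^esub> (b \<odot>\<^bsub>M\<^esub> x)"
    and smult_one: "x \<in> carrier M \<Longrightarrow> \<one>\<^bsub>R\<^esub> \<odot>\<^bsub>M\<^esub> x = x"

text \<open>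
  \<open>Ind\<^sub>B\<^sup>A M = A \<otimes>\<^sub>B M\<close> for a subring \<open>B\<close> of \<open>A\<close> and a left \<open>B\<close>-module \<open>M\<close>: the free abelian group
  on \<open>A \<times> M\<close> modulo biadditivity and \<open>ab \<otimes> x = a \<otimes> bx\<close>, with \<open>A\<close> acting by left multiplication on
  the first factor. Elements are cosets; the \<open>mult\<close> and \<open>one\<close> fields of the module record carry no
  meaning, as always for modules.
\<close>

definition ind_rels ::
  "('a, 'r) ring_scheme \<Rightarrow> ('a, 's) ring_scheme \<Rightarrow> ('a, 'v, 'm) module_scheme \<Rightarrow> ('a \<times> 'v \<Rightarrow>\<^sub>0 int) set"
where
  "ind_rels A B M =
     {frag_of (a \<oplus>\<^bsub>A\<^esub> a', x) - frag_of (a, x) - frag_of (a', x) | a a' x.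
        a \<in> carrier A \<and> a' \<in> carrier A \<and> x \<in> carrier M} \<union>
     {frag_of (a, x \<oplus>\<^bsub>M\<^esub> x') - frag_of (a, x) - frag_of (a, x') | a x x'.
        a \<in> carrier A \<and> x \<in> carrier M \<and> x' \<in> carrier M} \<union>
     {frag_of (a \<otimes>\<^bsub>A\<^esub> b, x) - frag_of (a, b \<odot>\<^bsub>M\<^esub> x) | a b x.
        a \<in> carrier A \<and> b \<in> carrier B \<and> x \<in> carrier M}"

definition ind_null ::
  "('a, 'r) ring_scheme \<Rightarrow> ('a, 's) ring_scheme \<Rightarrow> ('a, 'v, 'm) module_scheme \<Rightarrow> ('a \<times> 'v \<Rightarrow>\<^sub>0 int) set"
where
  "ind_null A B M = generate (free_Abelian_group (carrier A \<times> carrier M)) (ind_rels A B M)"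

definition ind_tensor ::
  "('a, 'r) ring_scheme \<Rightarrow> ('a, 's) ring_scheme \<Rightarrow> ('a, 'v, 'm) module_scheme \<Rightarrow>
    'a \<Rightarrow> 'v \<Rightarrow> ('a \<times> 'v \<Rightarrow>\<^sub>0 int) set"
where
  "ind_tensor A B M a x =
     ind_null A B M #>\<^bsub>free_Abelian_group (carrier A \<times> carrier M)\<^esub> frag_of (a, x)"

definition ind_module ::
  "('a, 'r) ring_scheme \<Rightarrow> ('a, 's) ring_scheme \<Rightarrow> ('a, 'v, 'm) module_scheme \<Rightarrow>
    ('a, ('a \<times> 'v \<Rightarrow>\<^sub>0 int) set) module"
where
  "ind_module A B M =
     (let F = free_Abelian_group (carrier A \<times> carrier M); N = ind_null A B M in
      \<lparr>carrier = carrier (F Mod N), monoid.mult = undefined, one = undefined,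
       zero = \<one>\<^bsub>F Mod N\<^esub>, add = monoid.mult (F Mod N),
       smult = (\<lambda>a X. N <#>\<^bsub>F\<^esub> (frag_extend (\<lambda>(b, x). frag_of (a \<otimes>\<^bsub>A\<^esub> b, x)) ` X))\<rparr>)"


section \<open>Polynomials and reflections\<close>

type_synonym mpoly = "(nat \<Rightarrow>\<^sub>0 nat) \<Rightarrow>\<^sub>0 complex"

definition pvar :: "nat \<Rightarrow> mpoly" where
  "pvar i = Poly_Mapping.single (Poly_Mapping.single i 1) 1"

definition polys :: "nat \<Rightarrow> mpoly set" where
  "polys n = {f. \<forall>m\<in>Poly_Mapping.keys f. Poly_Mapping.keys m \<subseteq> {1..n}}"

text \<open>Algebra endomorphism \<open>y\<^sub>i \<mapsto> \<sigma> i\<close>. An element of the Weyl group is given by the images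
  \<open>\<sigma> i = \<plusminus>y\<^sub>j\<close> of the variables.\<close>

definition psubst :: "(nat \<Rightarrow> mpoly) \<Rightarrow> mpoly \<Rightarrow> mpoly" where
  "psubst \<sigma> f = (\<Sum>m\<in>Poly_Mapping.keys f. Poly_Mapping.single 0 (Poly_Mapping.lookup f m) *
                   (\<Prod>i\<in>Poly_Mapping.keys m. \<sigma> i ^ Poly_Mapping.lookup m i))"

definition refl_s :: "nat \<Rightarrow> nat \<Rightarrow> nat \<Rightarrow> mpoly" where
  "refl_s i j k = (if k = i then pvar j else if k = j then pvar i else pvar k)"

definition refl_sbar :: "nat \<Rightarrow> nat \<Rightarrow> nat \<Rightarrow> mpoly" where
  "refl_sbar i j k = (if k = i then - pvar j else if k = j then - pvar i else pvar k)"

text \<open>Exact quotient; \<^typ>\<open>mpoly\<close> is an integral domain, so it is unique for \<open>q \<noteq> 0\<close>.\<close>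

definition pquot :: "mpoly \<Rightarrow> mpoly \<Rightarrow> mpoly" where
  "pquot p q = (THE g. g * q = p)"


section \<open>The spin Weyl group algebra of type D\<close>

datatype gen = Xi nat | Y nat | T nat

type_synonym falg = "gen free_algebra"

abbreviation gen_xi :: "nat \<Rightarrow> falg" where "gen_xi i \<equiv> word [Xi i]"
abbreviation gen_y :: "nat \<Rightarrow> falg" where "gen_y i \<equiv> word [Y i]"
abbreviation gen_t :: "nat \<Rightarrow> falg" where "gen_t i \<equiv> word [T i]"

definition t_up :: "nat \<Rightarrow> nat \<Rightarrow> falg" where
  "t_up i j = prod_list (map gen_t [i..<Suc j])"

definition t_down :: "nat \<Rightarrow> nat \<Rightarrow> falg" where
  "t_down i j = prod_list (map gen_t (rev [j..<Suc i]))"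

definition brack_lt :: "nat \<Rightarrow> nat \<Rightarrow> falg" where
  "brack_lt i j = (-1) ^ (j - i - 1) * t_down (j - 1) (i + 1) * gen_t i * t_up (i + 1) (j - 1)"

definition brack :: "nat \<Rightarrow> nat \<Rightarrow> falg" where
  "brack i j = (if i < j then brack_lt i j else - brack_lt j i)"

definition brackbar_lt :: "nat \<Rightarrow> nat \<Rightarrow> nat \<Rightarrow> falg" where
  "brackbar_lt n i j = (-1) ^ (j - i - 1) *
     t_up j (n - 1) * t_up i (n - 2) * gen_t n * t_down (n - 2) i * t_down (n - 1) j"

definition brackbar :: "nat \<Rightarrow> nat \<Rightarrow> nat \<Rightarrow> falg" where
  "brackbar n i j = (if i < j then brackbar_lt n i j else brackbar_lt n j i)"

definition spinW_gens :: "nat \<Rightarrow> gen set" where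
  "spinW_gens n = T ` {1..n}"

definition spinW_rels :: "nat \<Rightarrow> falg set" where
  "spinW_rels n =
     {gen_t i * gen_t i - 1 | i. i \<in> {1..n}} \<union>
     {gen_t i * gen_t (i + 1) * gen_t i - gen_t (i + 1) * gen_t i * gen_t (i + 1) | i. i \<in> {1..n - 2}} \<union>
     {(gen_t i * gen_t j)\<^sup>2 + 1 | i j. i \<in> {1..n - 1} \<and> j \<in> {1..n - 1} \<and> (i + 1 < j \<or> j + 1 < i)} \<union>
     {(gen_t i * gen_t n)\<^sup>2 + 1 | i. i \<in> {1..n} \<and> i \<noteq> n - 2 \<and> i \<noteq> n} \<union>
     {gen_t (n - 2) * gen_t n * gen_t (n - 2) - gen_t n * gen_t (n - 2) * gen_t n}"

definition spinW :: "nat \<Rightarrow> falg set ring" where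
  "spinW n = presented (spinW_gens n) (spinW_rels n)"

definition inW :: "nat \<Rightarrow> falg \<Rightarrow> falg set" where
  "inW n = pclass (spinW_gens n) (spinW_rels n)"


section \<open>The rational spin double affine Hecke algebra of type D\<close>

definition daha_gens :: "nat \<Rightarrow> gen set" where
  "daha_gens n = Xi ` {1..n} \<union> Y ` {1..n} \<union> T ` {1..n}"

definition daha_rels :: "nat \<Rightarrow> complex \<Rightarrow> falg set" where
  "daha_rels n u = spinW_rels n \<union>
     {gen_y i * gen_y j - gen_y j * gen_y i | i j. i \<in> {1..n} \<and> j \<in> {1..n}} \<union>
     {gen_xi i * gen_xi j + gen_xi j * gen_xi i | i j. i \<in> {1..n} \<and> j \<in> {1..n} \<and> i \<noteq> j} \<union>
     {gen_t i * gen_y i - gen_y (i + 1) * gen_t i | i. i \<in> {1..n - 1}} \<union>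
     {gen_t i * gen_xi i + gen_xi (i + 1) * gen_t i | i. i \<in> {1..n - 1}} \<union>
     {gen_t i * gen_y j - gen_y j * gen_t i | i j. i \<in> {1..n - 1} \<and> j \<in> {1..n} \<and> j \<noteq> i \<and> j \<noteq> i + 1} \<union>
     {gen_t i * gen_xi j + gen_xi j * gen_t i | i j. i \<in> {1..n - 1} \<and> j \<in> {1..n} \<and> j \<noteq> i \<and> j \<noteq> i + 1} \<union>
     {gen_t n * gen_y n + gen_y (n - 1) * gen_t n} \<union>
     {gen_t n * gen_xi n + gen_xi (n - 1) * gen_t n} \<union>
     {gen_t n * gen_y j - gen_y j * gen_t n | j. j \<in> {1..n} \<and> j \<noteq> n - 1 \<and> j \<noteq> n} \<union>
     {gen_t n * gen_xi j + gen_xi j * gen_t n | j. j \<in> {1..n} \<and> j \<noteq> n - 1 \<and> j \<noteq> n} \<union>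
     {gen_y j * gen_xi i - gen_xi i * gen_y j - (- (scalar u * brack i j) + scalar u * brackbar n i j) | i j.
        i \<in> {1..n} \<and> j \<in> {1..n} \<and> i \<noteq> j} \<union>
     {gen_y i * gen_xi i - gen_xi i * gen_y i - scalar u * (\<Sum>k\<in>{1..n} - {i}. brack i k + brackbar n i k) | i.
        i \<in> {1..n}}"

definition daha :: "nat \<Rightarrow> complex \<Rightarrow> falg set ring" where
  "daha n u = presented (daha_gens n) (daha_rels n u)"

definition inH :: "nat \<Rightarrow> complex \<Rightarrow> falg \<Rightarrow> falg set" where
  "inH n u = pclass (daha_gens n) (daha_rels n u)"

text \<open>The subalgebra generated by the \<open>\<xi>\<^sub>i\<close> and the image of the spin Weyl group algebra; the latter
  contains the scalars.\<close>

definition h_xi :: "nat \<Rightarrow> complex \<Rightarrow> falg set ring" where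
  "h_xi n u = (daha n u)\<lparr>carrier := generate_ring (daha n u)
     ((\<lambda>i. inH n u (gen_xi i)) ` {1..n} \<union> inH n u ` carrier (free_alg (spinW_gens n)))\<rparr>"

text \<open>
  \<open>\<beta>\<close> is the \<open>\<hh>\<^sub>\<xi>\<close>-action that extends the given \<open>\<complex>W\<^sup>-\<close>-module structure of \<open>V\<close> by letting all \<open>\<xi>\<^sub>i\<close>
  act by zero. It is unique on \<open>\<hh>\<^sub>\<xi>\<close>, and exists by the triangular decomposition.
\<close>

definition extends_by_zero ::
  "nat \<Rightarrow> complex \<Rightarrow> (falg set, 'v) module \<Rightarrow> (falg set \<Rightarrow> 'v \<Rightarrow> 'v) \<Rightarrow> bool"
where
  "extends_by_zero n u V \<beta> \<longleftrightarrow>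
     left_module (h_xi n u) (V\<lparr>smult := \<beta>\<rparr>) \<and>
     (\<forall>p\<in>carrier (free_alg (spinW_gens n)). \<forall>v\<in>carrier V. \<beta> (inH n u p) v = inW n p \<odot>\<^bsub>V\<^esub> v) \<and>
     (\<forall>i\<in>{1..n}. \<forall>v\<in>carrier V. \<beta> (inH n u (gen_xi i)) v = \<zero>\<^bsub>V\<^esub>)"

definition V_xi ::
  "nat \<Rightarrow> complex \<Rightarrow> (falg set, 'v) module \<Rightarrow> (falg set \<Rightarrow> 'v \<Rightarrow> 'v) \<Rightarrow>
    (falg set, (falg set \<times> 'v \<Rightarrow>\<^sub>0 int) set) module"
where
  "V_xi n u V \<beta> = ind_module (daha n u) (h_xi n u) (V\<lparr>smult := \<beta>\<rparr>)"

text \<open>\<open>f(y\<^sub>1,\<dots>,y\<^sub>n)\<close>, each monomial being written as \<open>y\<^sub>1\<^sup>a y\<^sub>2\<^sup>b \<cdots>\<close>.\<close>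

definition poly_y :: "nat \<Rightarrow> mpoly \<Rightarrow> falg" where
  "poly_y n f = (\<Sum>m\<in>Poly_Mapping.keys f. Poly_Mapping.single
     (concat (map (\<lambda>i. replicate (Poly_Mapping.lookup m i) (Y i)) [1..<Suc n]))
     (Poly_Mapping.lookup f m))"

text \<open>The element of \<open>V\<^sub>\<xi>\<close> that is written \<open>f \<otimes> v\<close> when \<open>V\<^sub>\<xi>\<close> is identified with
  \<open>\<complex>[y\<^sub>1,\<dots>,y\<^sub>n] \<otimes> V\<close>, namely \<open>f(y) \<otimes> v \<in> H \<otimes>\<^bsub>\<hh>\<^sub>\<xi>\<^esub> V\<close>.\<close>

definition poly_tensor ::
  "nat \<Rightarrow> complex \<Rightarrow> (falg set, 'v) module \<Rightarrow> (falg set \<Rightarrow> 'v \<Rightarrow> 'v) \<Rightarrow> mpoly \<Rightarrow> 'v \<Rightarrow>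
    (falg set \<times> 'v \<Rightarrow>\<^sub>0 int) set"
where
  "poly_tensor n u V \<beta> f v =
     ind_tensor (daha n u) (h_xi n u) (V\<lparr>smult := \<beta>\<rparr>) (inH n u (poly_y n f)) v"

end

(* In the algebra H one has, for every polynomial f,
     xi_i f = f xi_i + u sum_k q_k(f) [k,i] - u sum_k q'_k(f) bar[k,i],
   where q_k(f) = (f - s_ki f) / (y_i - y_k) and q'_k(f) = (f - sbar_ki f) / (y_i + y_k).
   For a variable this is one of the defining relations. It passes from f to y_l f because the
   divided differences satisfy the twisted Leibniz rule q(y_l f) = y_l q(f) + q(y_l) s(f), and
   because [k,i] f = s_ki(f) [k,i] and bar[k,i] f = sbar_ki(f) bar[k,i] in H. Applied to 1 (x) v
   the first term dies, since xi_i v = 0, and the brackets act on v by balancedness of the tensor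
   product. Only the universal relations of the tensor product are needed, not its freeness over the
   polynomials. *)
theory Submission
  imports Defs
begin

section \<open>Presented algebras\<close>

text \<open>Identities in H are proved as congruences between elements of the free algebra. There
  sums, products and associativity belong to a type, so plain rewriting applies; in the quotient
  record each step would carry membership conditions. The price is that a polynomial in the y's is
  represented by one fixed sum of sorted words, and this representative is multiplicative only up to
  congruence.

  Brackets are products of letters t_i, so their effect on a variable is followed letter by letter
  as a signed permutation of indices. A sign in front of a bracket cancels in
  \<open>x f = g x\<close>, so the spin signs leave no trace in that calculation. They decide the
  signs of the formula elsewhere, in the relation between xi_i and y_l, where [k,i] is antisymmetric
  and its barred version symmetric.

  The quotients of the theorem are definite descriptions. Nothing can be said about them before they
  are known to be exact, and the twisted Leibniz rule serves both to prove exactness and to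
  compute.\<close>

lemma free_alg_simps [simp]:
  "monoid.mult (free_alg G) = (*)" "one (free_alg G) = 1"
  "zero (free_alg G) = 0" "add (free_alg G) = (+)"
  by (simp_all add: free_alg_def)

lemma in_free_alg: "p \<in> carrier (free_alg G) \<longleftrightarrow> (\<forall>w\<in>Poly_Mapping.keys p. set w \<subseteq> G)"
  by (simp add: free_alg_def)

lemma free_alg_mono: "G \<subseteq> G' \<Longrightarrow> carrier (free_alg G) \<subseteq> carrier (free_alg G')"
  unfolding in_free_alg subset_iff by blast

lemma free_alg_0 [simp]: "0 \<in> carrier (free_alg G)"
  and free_alg_1 [simp]: "1 \<in> carrier (free_alg G)"
  by (simp_all add: in_free_alg zero_list_def)

lemma free_alg_add [simp]:
  "p \<in> carrier (free_alg G) \<Longrightarrow> q \<in> carrier (free_alg G) \<Longrightarrow> p + q \<in> carrier (free_alg G)"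
  using Poly_Mapping.keys_add[of p q] by (auto simp: in_free_alg)

lemma free_alg_uminus [simp]: "- p \<in> carrier (free_alg G) \<longleftrightarrow> p \<in> carrier (free_alg G)"
  by (simp add: in_free_alg keys_def)

lemma free_alg_diff [simp]:
  "p \<in> carrier (free_alg G) \<Longrightarrow> q \<in> carrier (free_alg G) \<Longrightarrow> p - q \<in> carrier (free_alg G)"
  using free_alg_add[of p G "- q"] by simp

lemma free_alg_mult [simp]:
  assumes "p \<in> carrier (free_alg G)" "q \<in> carrier (free_alg G)"
  shows "p * q \<in> carrier (free_alg G)"
  unfolding in_free_alg
proof
  fix w assume "w \<in> Poly_Mapping.keys (p * q)"
  then obtain a b where "w = a + b" "a \<in> Poly_Mapping.keys p" "b \<in> Poly_Mapping.keys q"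
    using keys_mult[of p q] by blast
  with assms show "set w \<subseteq> G"
    by (auto simp: in_free_alg plus_list_def)
qed

lemma free_alg_single: "set w \<subseteq> G \<Longrightarrow> Poly_Mapping.single w c \<in> carrier (free_alg G)"
  by (auto simp: in_free_alg split: if_splits)

lemma free_alg_power [simp]: "p \<in> carrier (free_alg G) \<Longrightarrow> p ^ k \<in> carrier (free_alg G)"
  by (induction k) auto

lemma free_alg_prod_list:
  "(\<And>p. p \<in> set ps \<Longrightarrow> p \<in> carrier (free_alg G)) \<Longrightarrow> prod_list ps \<in> carrier (free_alg G)"
  by (induction ps) auto

lemma free_alg_sum [simp]:
  "(\<And>k. k \<in> K \<Longrightarrow> p k \<in> carrier (free_alg G)) \<Longrightarrow> sum p K \<in> carrier (free_alg G)"
  by (induction K rule: infinite_finite_induct) auto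

lemma ring_free_alg: "ring (free_alg G)"
proof (rule ringI)
  show "abelian_group (free_alg G)"
  proof (rule abelian_groupI)
    show "\<exists>y\<in>carrier (free_alg G). y \<oplus>\<^bsub>free_alg G\<^esub> x = \<zero>\<^bsub>free_alg G\<^esub>"
      if "x \<in> carrier (free_alg G)" for x
      using that by (intro bexI[of _ "- x"]) auto
  qed (auto simp: algebra_simps)
  show "monoid (free_alg G)"
    by (rule monoidI) (auto simp: algebra_simps)
qed (auto simp: algebra_simps)

text \<open>An update at a point outside the support is the addition of a single term, so an
  additive property only has to be checked on terms. Zero needs no case of its own, being a term
  with coefficient 0.\<close>

lemma poly_mapping_add_induct [case_names single add]:
  assumes "\<And>k v. P (Poly_Mapping.single k v)" "\<And>f g. P f \<Longrightarrow> P g \<Longrightarrow> P (f + g)"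
  shows "P (f :: 'a \<Rightarrow>\<^sub>0 'b::comm_monoid_add)"
proof (induction f rule: update_induct)
  case const
  show ?case using assms(1)[of undefined 0] by simp
next
  case (update f k v)
  then have "Poly_Mapping.update k v f = f + Poly_Mapping.single k v"
    by (intro poly_mapping_eqI) (auto simp: lookup_update lookup_add lookup_single when_def in_keys_iff)
  with update assms show ?case by simp
qed

text \<open>A scalar sits on the empty word, which is neutral for concatenation on either
  side.\<close>

lemma scalar_commute: "scalar c * p = p * scalar c"
  by (induction p rule: poly_mapping_add_induct)
    (simp_all add: mult_single plus_list_def mult.commute distrib_left distrib_right)

locale presentation =
  fixes G :: "'g set" and R :: "'g free_algebra set"
  assumes rels: "R \<subseteq> carrier (free_alg G)"
begin

abbreviation (input) "C \<equiv> carrier (free_alg G)"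
abbreviation (input) "I \<equiv> Idl\<^bsub>free_alg G\<^esub> R"

sublocale fa: ring "free_alg G"
  by (rule ring_free_alg)

sublocale idl: ideal I "free_alg G"
  by (rule fa.genideal_ideal[OF rels])

sublocale quot: ring "presented G R"
  unfolding presented_def by (rule idl.quotient_is_ring)

lemma pclass_closed [simp]: "p \<in> C \<Longrightarrow> pclass G R p \<in> carrier (presented G R)"
  by (auto simp: presented_def pclass_def FactRing_def A_RCOSETS_def')

lemma pclass_add:
  "p \<in> C \<Longrightarrow> q \<in> C \<Longrightarrow> pclass G R (p + q) = pclass G R p \<oplus>\<^bsub>presented G R\<^esub> pclass G R q"
  by (simp add: presented_def pclass_def FactRing_def idl.a_rcos_sum)

lemma pclass_mult:
  "p \<in> C \<Longrightarrow> q \<in> C \<Longrightarrow> pclass G R (p * q) = pclass G R p \<otimes>\<^bsub>presented G R\<^esub> pclass G R q"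
  by (simp add: presented_def pclass_def FactRing_def idl.rcoset_mult_add)

text \<open>Membership of both sides is built in, so a chain of congruences also delivers it for its
  end points.\<close>

definition eqv :: "'g free_algebra \<Rightarrow> 'g free_algebra \<Rightarrow> bool" (infix \<open>\<sim>\<close> 50) where
  "p \<sim> q \<longleftrightarrow> p \<in> C \<and> q \<in> C \<and> p - q \<in> I"

lemma idl_uminus: "p \<in> I \<Longrightarrow> - p \<in> I"
  using idl.I_l_closed[of p "- 1"] by simp

lemma eqv_rel: "p \<in> C \<Longrightarrow> q \<in> C \<Longrightarrow> p - q \<in> R \<Longrightarrow> p \<sim> q"
  using fa.genideal_self[OF rels] by (auto simp: eqv_def)

lemma eqv_refl [simp, intro]: "p \<in> C \<Longrightarrow> p \<sim> p"
  using idl.zero_closed by (simp add: eqv_def)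

lemma eqv_sym: "p \<sim> q \<Longrightarrow> q \<sim> p"
  using idl_uminus[of "p - q"] by (simp add: eqv_def)

lemma eqv_trans [trans]: "p \<sim> q \<Longrightarrow> q \<sim> r \<Longrightarrow> p \<sim> r"
  using idl.a_closed[of "p - q" "q - r"] by (simp add: eqv_def)

lemma eqv_add: "p \<sim> p' \<Longrightarrow> q \<sim> q' \<Longrightarrow> p + q \<sim> p' + q'"
  using idl.a_closed[of "p - p'" "q - q'"] by (auto simp: eqv_def algebra_simps)

lemma eqv_uminus: "p \<sim> p' \<Longrightarrow> - p \<sim> - p'"
  using idl_uminus[of "p - p'"] by (auto simp: eqv_def)

lemma eqv_diff: "p \<sim> p' \<Longrightarrow> q \<sim> q' \<Longrightarrow> p - q \<sim> p' - q'"
  using eqv_add[OF _ eqv_uminus, of p p' q q'] by simp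

lemma eqv_mult:
  assumes "p \<sim> p'" "q \<sim> q'"
  shows "p * q \<sim> p' * q'"
proof -
  \<comment> \<open>This is \<open>p * q - p' * q'\<close>, written so that each summand has one
    factor in the two-sided ideal.\<close>
  have "(p - p') * q + p' * (q - q') \<in> I"
    using assms idl.I_r_closed[of "p - p'" q] idl.I_l_closed[of "q - q'" p']
      idl.a_closed[of "(p - p') * q" "p' * (q - q')"]
    by (simp add: eqv_def)
  then show ?thesis
    using assms by (simp add: eqv_def algebra_simps)
qed

lemma eqv_mult_left: "p \<sim> p' \<Longrightarrow> q \<in> C \<Longrightarrow> q * p \<sim> q * p'"
  by (rule eqv_mult) auto

lemma eqv_mult_right: "p \<sim> p' \<Longrightarrow> q \<in> C \<Longrightarrow> p * q \<sim> p' * q"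
  by (rule eqv_mult) auto

lemma eqv_sum: "(\<And>k. k \<in> K \<Longrightarrow> p k \<sim> q k) \<Longrightarrow> sum p K \<sim> sum q K"
  by (induction K rule: infinite_finite_induct) (auto intro: eqv_add)

text \<open>The passage from congruences of representatives to equalities in the presented
  algebra.\<close>

lemma pclass_eqI:
  assumes "p \<sim> q"
  shows "pclass G R p = pclass G R q"
proof -
  have "p = (p - q) \<oplus>\<^bsub>free_alg G\<^esub> q"
    by simp
  then have "p \<in> pclass G R q"
    using assms unfolding pclass_def a_r_coset_def' eqv_def by blast
  then show ?thesis
    using assms idl.a_repr_independence' unfolding pclass_def eqv_def by metis
qed

end

section \<open>Induced modules\<close>

locale induced =
  fixes A :: "('a, 'r) ring_scheme" and B :: "('a, 's) ring_scheme"
    and M :: "('a, 'v, 'm) module_scheme"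
  assumes ring_A: "ring A" and sub: "carrier B \<subseteq> carrier A"
    and group_M: "abelian_group M"
    and act_closed: "b \<in> carrier B \<Longrightarrow> x \<in> carrier M \<Longrightarrow> b \<odot>\<^bsub>M\<^esub> x \<in> carrier M"
begin

abbreviation (input) "F \<equiv> free_Abelian_group (carrier A \<times> carrier M)"
abbreviation (input) "N \<equiv> ind_null A B M"
abbreviation (input) "Ind \<equiv> ind_module A B M"
abbreviation tensor (infix \<open>\<otimes>\<^sub>t\<close> 70) where "tensor \<equiv> ind_tensor A B M"

sublocale A: ring A by (rule ring_A)
sublocale M: abelian_group M by (rule group_M)
sublocale F: comm_group F by (rule abelian_free_Abelian_group)

lemma rels_closed: "ind_rels A B M \<subseteq> carrier F"
proof -
  have diff: "p - q \<in> carrier F" if "p \<in> carrier F" "q \<in> carrier F" for p q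
    using that keys_diff[of p q] by auto
  show ?thesis
    using sub act_closed unfolding ind_rels_def
    by (auto intro!: diff simp: subset_iff simp del: carrier_free_Abelian_group_iff)
qed

lemma null_subgroup: "subgroup N F"
  unfolding ind_null_def by (rule F.generate_is_subgroup[OF rels_closed])

sublocale N: subgroup N F by (rule null_subgroup)

lemma null_normal: "N \<lhd> F"
  by (rule F.subgroup_imp_normal[OF null_subgroup])

sublocale Q: comm_group "F Mod N"
  by (rule F.abelian_FactGroup[OF null_subgroup])

lemma ind_simps [simp]:
  "carrier Ind = carrier (F Mod N)" "zero Ind = \<one>\<^bsub>F Mod N\<^esub>" "add Ind = monoid.mult (F Mod N)"
  by (simp_all add: ind_module_def Let_def)

lemma abelian_group_ind: "abelian_group Ind"
proof (rule abelian_groupI)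
  show "\<exists>y\<in>carrier Ind. y \<oplus>\<^bsub>Ind\<^esub> x = \<zero>\<^bsub>Ind\<^esub>" if "x \<in> carrier Ind" for x
    using that Q.l_inv_ex unfolding ind_simps by blast
qed (unfold ind_simps, rule Q.m_closed Q.one_closed Q.m_assoc Q.m_comm Q.l_one; assumption)+

lemma rcos_eqI:
  assumes "p \<in> carrier F" "q \<in> carrier F" "p - q \<in> N"
  shows "N #>\<^bsub>F\<^esub> p = N #>\<^bsub>F\<^esub> q"
proof -
  have "p \<in> N #>\<^bsub>F\<^esub> q"
    using assms(3) by (auto simp: r_coset_def intro!: bexI[of _ "p - q"])
  then show ?thesis
    using F.repr_independence[OF _ assms(2) null_subgroup] by simp
qed

lemma rcos_add:
  assumes "p \<in> carrier F" "q \<in> carrier F"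
  shows "(N #>\<^bsub>F\<^esub> p) \<oplus>\<^bsub>Ind\<^esub> (N #>\<^bsub>F\<^esub> q) = N #>\<^bsub>F\<^esub> (p + q)"
  using normal.rcos_sum[OF null_normal assms] by (simp add: FactGroup_def)

lemma keys_frag: "a \<in> carrier A \<Longrightarrow> x \<in> carrier M \<Longrightarrow> frag_of (a, x) \<in> carrier F"
  by simp

lemma tensor_closed [simp]:
  "a \<in> carrier A \<Longrightarrow> x \<in> carrier M \<Longrightarrow> a \<otimes>\<^sub>t x \<in> carrier Ind"
  by (auto simp: FactGroup_def RCOSETS_def ind_tensor_def)

lemma rel_null: "p \<in> ind_rels A B M \<Longrightarrow> p \<in> N"
  unfolding ind_null_def by (rule generate.incl)

lemma add_in_F: "p \<in> carrier F \<Longrightarrow> q \<in> carrier F \<Longrightarrow> p + q \<in> carrier F"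
  using F.m_closed[of p q] by simp

lemma tensor_add_left:
  assumes "a \<in> carrier A" "a' \<in> carrier A" "x \<in> carrier M"
  shows "(a \<oplus>\<^bsub>A\<^esub> a') \<otimes>\<^sub>t x = (a \<otimes>\<^sub>t x) \<oplus>\<^bsub>Ind\<^esub> (a' \<otimes>\<^sub>t x)"
proof -
  have "frag_of (a \<oplus>\<^bsub>A\<^esub> a', x) - frag_of (a, x) - frag_of (a', x) \<in> N"
    using assms by (intro rel_null) (auto simp: ind_rels_def)
  then have "N #>\<^bsub>F\<^esub> frag_of (a \<oplus>\<^bsub>A\<^esub> a', x) = N #>\<^bsub>F\<^esub> (frag_of (a, x) + frag_of (a', x))"
    using assms by (intro rcos_eqI add_in_F keys_frag) (simp_all add: diff_diff_eq)
  then show ?thesis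
    unfolding ind_tensor_def using assms by (simp only: rcos_add keys_frag)
qed

lemma tensor_add_right:
  assumes "a \<in> carrier A" "x \<in> carrier M" "x' \<in> carrier M"
  shows "a \<otimes>\<^sub>t (x \<oplus>\<^bsub>M\<^esub> x') = (a \<otimes>\<^sub>t x) \<oplus>\<^bsub>Ind\<^esub> (a \<otimes>\<^sub>t x')"
proof -
  have "frag_of (a, x \<oplus>\<^bsub>M\<^esub> x') - frag_of (a, x) - frag_of (a, x') \<in> N"
    using assms by (intro rel_null) (auto simp: ind_rels_def)
  then have "N #>\<^bsub>F\<^esub> frag_of (a, x \<oplus>\<^bsub>M\<^esub> x') = N #>\<^bsub>F\<^esub> (frag_of (a, x) + frag_of (a, x'))"
    using assms by (intro rcos_eqI add_in_F keys_frag) (simp_all add: diff_diff_eq)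
  then show ?thesis
    unfolding ind_tensor_def using assms by (simp only: rcos_add keys_frag)
qed

lemma tensor_balanced:
  assumes "a \<in> carrier A" "b \<in> carrier B" "x \<in> carrier M"
  shows "(a \<otimes>\<^bsub>A\<^esub> b) \<otimes>\<^sub>t x = a \<otimes>\<^sub>t (b \<odot>\<^bsub>M\<^esub> x)"
proof -
  have "frag_of (a \<otimes>\<^bsub>A\<^esub> b, x) - frag_of (a, b \<odot>\<^bsub>M\<^esub> x) \<in> N"
    using assms by (intro rel_null) (auto simp: ind_rels_def)
  then show ?thesis
    unfolding ind_tensor_def
    using assms sub act_closed by (intro rcos_eqI) auto
qed

text \<open>Additivity in the second factor gives \<open>z + z = z\<close>, which forces
  \<open>z = 0\<close> in a group.\<close>

lemma tensor_zero: 
  assumes "a \<in> carrier A" 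
  shows "a \<otimes>\<^sub>t \<zero>\<^bsub>M\<^esub> = \<zero>\<^bsub>Ind\<^esub>"
proof -
  interpret I: abelian_group Ind by (rule abelian_group_ind)
  have "(a \<otimes>\<^sub>t \<zero>\<^bsub>M\<^esub>) \<oplus>\<^bsub>Ind\<^esub> (a \<otimes>\<^sub>t \<zero>\<^bsub>M\<^esub>) = a \<otimes>\<^sub>t \<zero>\<^bsub>M\<^esub>"
    using tensor_add_right[of a "\<zero>\<^bsub>M\<^esub>" "\<zero>\<^bsub>M\<^esub>"] assms by simp
  then show ?thesis
    using assms tensor_closed[of a "\<zero>\<^bsub>M\<^esub>"]
    by (metis I.add.r_cancel_one M.zero_closed)
qed

section \<open>The action of the ring on the induced module\<close>

abbreviation (input) lmult :: "'a \<Rightarrow> ('a \<times> 'v \<Rightarrow>\<^sub>0 int) \<Rightarrow> ('a \<times> 'v \<Rightarrow>\<^sub>0 int)" where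
  "lmult a \<equiv> frag_extend (\<lambda>(b, x). frag_of (a \<otimes>\<^bsub>A\<^esub> b, x))"

text \<open>Each family of relations is preserved for its own reason: the first by distributivity,
  the second because the first factor is merely replaced, the third by associativity. This is what
  makes the action on cosets well defined.\<close>

lemma lmult_rels:
  assumes "a \<in> carrier A" "p \<in> ind_rels A B M"
  shows "lmult a p \<in> ind_rels A B M"
proof -
  consider b b' x where "p = frag_of (b \<oplus>\<^bsub>A\<^esub> b', x) - frag_of (b, x) - frag_of (b', x)"
      "b \<in> carrier A" "b' \<in> carrier A" "x \<in> carrier M"
    | b x x' where "p = frag_of (b, x \<oplus>\<^bsub>M\<^esub> x') - frag_of (b, x) - frag_of (b, x')"
      "b \<in> carrier A" "x \<in> carrier M" "x' \<in> carrier M"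
    | b c x where "p = frag_of (b \<otimes>\<^bsub>A\<^esub> c, x) - frag_of (b, c \<odot>\<^bsub>M\<^esub> x)"
      "b \<in> carrier A" "c \<in> carrier B" "x \<in> carrier M"
    using assms(2) unfolding ind_rels_def by blast
  then show ?thesis
  proof cases
    case 1
    then show ?thesis
      using assms(1) unfolding ind_rels_def
      by (intro UnI1 CollectI exI[of _ "a \<otimes>\<^bsub>A\<^esub> b"] exI[of _ "a \<otimes>\<^bsub>A\<^esub> b'"] exI[of _ x])
        (simp add: frag_extend_diff A.r_distr)
  next
    case 2
    then show ?thesis
      using assms(1) unfolding ind_rels_def
      by (intro UnI1[OF UnI2] CollectI exI[of _ "a \<otimes>\<^bsub>A\<^esub> b"] exI[of _ x] exI[of _ x'])
        (simp add: frag_extend_diff)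
  next
    case 3
    then show ?thesis
      using assms(1) sub unfolding ind_rels_def
      by (intro UnI2 CollectI exI[of _ "a \<otimes>\<^bsub>A\<^esub> b"] exI[of _ c] exI[of _ x])
        (auto simp: frag_extend_diff A.m_assoc subset_iff)
  qed
qed

lemma lmult_null:
  assumes "a \<in> carrier A" "p \<in> N"
  shows "lmult a p \<in> N"
  using assms(2) unfolding ind_null_def
proof (induction rule: generate.induct)
  case one
  show ?case
    using generate.one[of F] by simp
next
  case (incl h)
  then show ?case
    using lmult_rels[OF assms(1)] by (intro generate.incl)
next
  case (inv h)
  \<comment> \<open>The inverse of the group record is rewritten to negation only for elements
    supported in the carrier, hence these two facts.\<close>
  have keys: "Poly_Mapping.keys h \<subseteq> carrier A \<times> carrier M"
    "Poly_Mapping.keys (lmult a h) \<subseteq> carrier A \<times> carrier M"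
    using subsetD[OF rels_closed inv] subsetD[OF rels_closed lmult_rels[OF assms(1) inv]]
    by simp_all
  have "inv\<^bsub>F\<^esub> (lmult a h) \<in> generate F (ind_rels A B M)"
    using inv lmult_rels[OF assms(1)] by (intro generate.inv)
  then show ?case
    using keys by (simp add: frag_extend_minus)
next
  case (eng h1 h2)
  then show ?case
    using generate.eng[of "lmult a h1" F _ "lmult a h2"] by (simp add: frag_extend_add)
qed

text \<open>The action adds \<open>N\<close> to the image of a whole coset. Since
  \<open>lmult a\<close> maps \<open>N\<close> into \<open>N\<close>, this stays inside one coset of
  \<open>N\<close>; since the image contains the image of the representative, it is all of that
  coset.\<close>

lemma smult_tensor:
  assumes "a \<in> carrier A" "b \<in> carrier A" "x \<in> carrier M"
  shows "a \<odot>\<^bsub>Ind\<^esub> (b \<otimes>\<^sub>t x) = (a \<otimes>\<^bsub>A\<^esub> b) \<otimes>\<^sub>t x"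
proof -
  let ?p = "frag_of (b, x)" and ?q = "frag_of (a \<otimes>\<^bsub>A\<^esub> b, x)"
  have null: "h \<otimes>\<^bsub>F\<^esub> lmult a h' \<in> N" if "h \<in> N" "h' \<in> N" for h h'
    using N.m_closed[OF that(1) lmult_null[OF assms(1) that(2)]] .
  have "N <#>\<^bsub>F\<^esub> (lmult a ` (N #>\<^bsub>F\<^esub> ?p)) = N #>\<^bsub>F\<^esub> ?q"
  proof
    show "N <#>\<^bsub>F\<^esub> (lmult a ` (N #>\<^bsub>F\<^esub> ?p)) \<subseteq> N #>\<^bsub>F\<^esub> ?q"
    proof
      fix z assume "z \<in> N <#>\<^bsub>F\<^esub> (lmult a ` (N #>\<^bsub>F\<^esub> ?p))"
      then obtain h h' where h: "h \<in> N" "h' \<in> N" "z = h + lmult a (h' + ?p)"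
        by (auto simp: set_mult_def r_coset_def)
      then have "z = (h \<otimes>\<^bsub>F\<^esub> lmult a h') + ?q"
        by (simp add: frag_extend_add add.assoc)
      with null[OF h(1,2)] show "z \<in> N #>\<^bsub>F\<^esub> ?q"
        by (auto simp: r_coset_def)
    qed
    show "N #>\<^bsub>F\<^esub> ?q \<subseteq> N <#>\<^bsub>F\<^esub> (lmult a ` (N #>\<^bsub>F\<^esub> ?p))"
    proof
      fix z assume "z \<in> N #>\<^bsub>F\<^esub> ?q"
      then obtain h where h: "h \<in> N" "z = h + ?q"
        by (auto simp: r_coset_def)
      have "?p \<in> N #>\<^bsub>F\<^esub> ?p"
        using F.rcos_self[of ?p N] assms null_subgroup by simp
      then have "?q \<in> lmult a ` (N #>\<^bsub>F\<^esub> ?p)"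
        by (rule rev_image_eqI) simp
      with h(1) show "z \<in> N <#>\<^bsub>F\<^esub> (lmult a ` (N #>\<^bsub>F\<^esub> ?p))"
        unfolding h(2) set_mult_def mult_free_Abelian_group by blast
    qed
  qed
  then show ?thesis
    by (simp add: ind_module_def ind_tensor_def Let_def)
qed

end

section \<open>Divided differences\<close>

abbreviation const :: "complex \<Rightarrow> mpoly" where
  "const c \<equiv> Poly_Mapping.single 0 c"

lemma polys_const [simp]: "const c \<in> polys n"
  and polys_0 [simp]: "0 \<in> polys n"
  and polys_1 [simp]: "1 \<in> polys n"
  by (simp_all add: polys_def)

lemma polys_pvar [simp]: "pvar l \<in> polys n \<longleftrightarrow> l \<in> {1..n}"
  by (simp add: polys_def pvar_def)

lemma polys_add [simp]: "f \<in> polys n \<Longrightarrow> g \<in> polys n \<Longrightarrow> f + g \<in> polys n"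
  using Poly_Mapping.keys_add[of f g] unfolding polys_def by blast

lemma polys_uminus [simp]: "- f \<in> polys n \<longleftrightarrow> f \<in> polys n"
  by (simp add: polys_def keys_def)

lemma polys_mult [simp]:
  assumes "f \<in> polys n" "g \<in> polys n"
  shows "f * g \<in> polys n"
  unfolding polys_def
proof (intro CollectI ballI)
  fix m assume "m \<in> Poly_Mapping.keys (f * g)"
  then obtain a b where "m = a + b" "a \<in> Poly_Mapping.keys f" "b \<in> Poly_Mapping.keys g"
    using keys_mult[of f g] by blast
  moreover from this have "Poly_Mapping.keys a \<subseteq> {1..n}" "Poly_Mapping.keys b \<subseteq> {1..n}"
    using assms by (auto simp: polys_def)
  ultimately show "Poly_Mapping.keys m \<subseteq> {1..n}"
    using Poly_Mapping.keys_add[of a b] by blast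
qed

lemma pvar_mult_single:
  "pvar l * Poly_Mapping.single m c = Poly_Mapping.single (Poly_Mapping.single l 1 + m) c"
  by (simp add: pvar_def mult_single)

text \<open>Polynomials are built up by one variable at a time because the defining relations of H,
  and the twisted Leibniz rule, speak of a single variable.\<close>

lemma polys_induct [consumes 1, case_names const add pvar]:
  assumes f: "f \<in> polys n"
    and const: "\<And>c. P (const c)"
    and add: "\<And>f g. f \<in> polys n \<Longrightarrow> g \<in> polys n \<Longrightarrow> P f \<Longrightarrow> P g \<Longrightarrow> P (f + g)"
    and pvar: "\<And>l f. l \<in> {1..n} \<Longrightarrow> f \<in> polys n \<Longrightarrow> P f \<Longrightarrow> P (pvar l * f)"
  shows "P f"
proof -
  have monom: "P (Poly_Mapping.single m c)" if "Poly_Mapping.keys m \<subseteq> {1..n}" for m c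
    using that
  proof (induction m rule: update_induct)
    case const
    show ?case by (rule assms(2))
  next
    case (update m k v)
    have k: "k \<in> {1..n}" and m: "Poly_Mapping.keys m \<subseteq> {1..n}"
      using update.prems update.hyps by (auto simp: keys_update split: if_splits)
    \<comment> \<open>The exponent of variable \<open>k\<close> grows by one with each factor
      \<open>pvar k\<close>; the value \<open>v\<close> of the update is then one instance.\<close>
    have P: "P (Poly_Mapping.single (m + Poly_Mapping.single k j) c)" for j
    proof (induction j)
      case 0
      then show ?case using update.IH[OF m] by simp
    next
      case (Suc j)
      have "Poly_Mapping.single (m + Poly_Mapping.single k (Suc j)) c =
          pvar k * Poly_Mapping.single (m + Poly_Mapping.single k j) c"
        by (simp add: pvar_mult_single ac_simps flip: single_add)
      moreover have "Poly_Mapping.single (m + Poly_Mapping.single k j) c \<in> polys n"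
        using k m Poly_Mapping.keys_add[of m "Poly_Mapping.single k j"]
        by (auto simp: polys_def split: if_splits)
      ultimately show ?case using pvar[OF k _ Suc] by simp
    qed
    have "Poly_Mapping.update k v m = m + Poly_Mapping.single k v"
      using update.hyps
      by (intro poly_mapping_eqI) (auto simp: lookup_update lookup_add lookup_single when_def in_keys_iff)
    with P show ?case by simp
  qed
  have "f \<in> polys n \<and> P f"
    using f
  proof (induction f rule: update_induct)
    case const
    show ?case using assms(2)[of 0] by simp
  next
    case (update f m c)
    have keys: "Poly_Mapping.keys (Poly_Mapping.update m c f) = insert m (Poly_Mapping.keys f)"
      using update.hyps by (simp add: keys_update)
    have f: "f \<in> polys n" and m: "Poly_Mapping.keys m \<subseteq> {1..n}"
      using update.prems by (auto simp: polys_def keys)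
    have "Poly_Mapping.update m c f = f + Poly_Mapping.single m c"
      using update.hyps
      by (intro poly_mapping_eqI) (auto simp: lookup_update lookup_add lookup_single when_def in_keys_iff)
    moreover have "Poly_Mapping.single m c \<in> polys n"
      using m by (simp add: polys_def)
    ultimately show ?case
      using add[OF f _ _ monom[OF m, of c]] update.IH[OF f] f by auto
  qed
  then show ?thesis by simp
qed

lemma psubst_single:
  "psubst \<sigma> (Poly_Mapping.single m c) = const c * (\<Prod>i\<in>Poly_Mapping.keys m. \<sigma> i ^ Poly_Mapping.lookup m i)"
  by (simp add: psubst_def)

lemma psubst_const [simp]: "psubst \<sigma> (const c) = const c"
  by (simp add: psubst_single)

lemma psubst_add: "psubst \<sigma> (f + g) = psubst \<sigma> f + psubst \<sigma> g"
  unfolding psubst_def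
  by (rule setsum_keys_plus_distrib) (simp_all add: single_add distrib_right)

lemma psubst_pvar_mult: "psubst \<sigma> (pvar l * f) = \<sigma> l * psubst \<sigma> f"
proof (induction f rule: poly_mapping_add_induct)
  case (single m c)
  \<comment> \<open>Multiplication by y_l may enlarge the support of the exponent vector. Both
    products are therefore taken over the common index set \<open>?K\<close>, where an extra index
    contributes a zeroth power.\<close>
  let ?m = "Poly_Mapping.single l 1 + m" and ?K = "insert l (Poly_Mapping.keys m)"
  have 1: "(\<Prod>i\<in>Poly_Mapping.keys m'. \<sigma> i ^ Poly_Mapping.lookup m' i) = (\<Prod>i\<in>?K. \<sigma> i ^ Poly_Mapping.lookup m' i)"
    if "Poly_Mapping.keys m' \<subseteq> ?K" for m'
    using that by (intro prod.mono_neutral_left) (auto simp: in_keys_iff)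
  have 2: "\<sigma> i ^ Poly_Mapping.lookup ?m i = (if i = l then \<sigma> l else 1) * \<sigma> i ^ Poly_Mapping.lookup m i" for i
    by (simp add: lookup_add lookup_single when_def)
  have "Poly_Mapping.keys ?m \<subseteq> ?K"
    using Poly_Mapping.keys_add[of "Poly_Mapping.single l 1" m] by auto
  from 1[OF this] have "psubst \<sigma> (Poly_Mapping.single ?m c) =
      const c * (\<Prod>i\<in>?K. (if i = l then \<sigma> l else 1) * \<sigma> i ^ Poly_Mapping.lookup m i)"
    by (simp only: psubst_single 2)
  also have "\<dots> = \<sigma> l * psubst \<sigma> (Poly_Mapping.single m c)"
    using 1[of m] by (simp add: psubst_single prod.distrib ac_simps subset_insertI)
  finally show ?case
    by (simp add: pvar_mult_single)
qed (simp add: psubst_add distrib_left)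

lemma psubst_polys:
  assumes "f \<in> polys n" "\<And>l. l \<in> {1..n} \<Longrightarrow> \<sigma> l \<in> polys n"
  shows "psubst \<sigma> f \<in> polys n"
  using assms(1) by (induction rule: polys_induct) (simp_all add: psubst_add psubst_pvar_mult assms(2))

lemma pquot_eqI: "q \<noteq> 0 \<Longrightarrow> g * q = p \<Longrightarrow> pquot p q = g"
  unfolding pquot_def by (rule the_equality) auto

text \<open>Keeps both kinds of reflection under one roof: \<open>d\<close> will be
  \<open>y_i - y_k\<close> for s_ki and \<open>y_i + y_k\<close> for its barred version. Unfolded,
  it is the quotient that stands in the theorem.\<close>

definition divdiff :: "(nat \<Rightarrow> mpoly) \<Rightarrow> mpoly \<Rightarrow> mpoly \<Rightarrow> mpoly" where
  "divdiff \<sigma> d f = pquot (f - psubst \<sigma> f) d"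

text \<open>\<open>c l\<close> is the divided difference of \<open>y\<^sub>l\<close>; it is a polynomial, which makes all quotients exact.\<close>

locale divided_difference =
  fixes n :: nat and \<sigma> :: "nat \<Rightarrow> mpoly" and d :: mpoly and c :: "nat \<Rightarrow> mpoly"
  assumes \<sigma>_polys: "l \<in> {1..n} \<Longrightarrow> \<sigma> l \<in> polys n" and c_polys: "l \<in> {1..n} \<Longrightarrow> c l \<in> polys n"
    and d_nonzero: "d \<noteq> 0"
    and pvar_diff: "l \<in> {1..n} \<Longrightarrow> pvar l - \<sigma> l = c l * d"
begin

abbreviation (input) dd :: "mpoly \<Rightarrow> mpoly" where
  "dd \<equiv> divdiff \<sigma> d"

lemma dd_eqI: "g * d = f - psubst \<sigma> f \<Longrightarrow> dd f = g"
  unfolding divdiff_def by (rule pquot_eqI[OF d_nonzero])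

lemma dd_const [simp]: "dd (const a) = 0"
  by (rule dd_eqI) simp

text \<open>The quotient is multiplied out and replaced by a witness \<open>g\<close>, so that the
  rule can be applied inside the very induction that proves the quotient exact.\<close>

lemma twisted_leibniz:
  assumes "l \<in> {1..n}" "g * d = f - psubst \<sigma> f"
  shows "(pvar l * g + c l * psubst \<sigma> f) * d = pvar l * f - psubst \<sigma> (pvar l * f)"
proof -
  have "(pvar l * g + c l * psubst \<sigma> f) * d = pvar l * (g * d) + (c l * d) * psubst \<sigma> f"
    by (simp add: algebra_simps)
  also have "\<dots> = pvar l * (f - psubst \<sigma> f) + (pvar l - \<sigma> l) * psubst \<sigma> f"
    by (simp only: assms(2) pvar_diff[OF assms(1)])
  also have "\<dots> = pvar l * f - psubst \<sigma> (pvar l * f)"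
    unfolding psubst_pvar_mult by (simp add: algebra_simps)
  finally show ?thesis .
qed

text \<open>The induction produces an explicit quotient at each stage, and uniqueness of quotients
  in an integral domain identifies it with \<open>dd f\<close>.\<close>

lemma dd_works:
  assumes "f \<in> polys n"
  shows "dd f \<in> polys n \<and> dd f * d = f - psubst \<sigma> f"
  using assms
proof (induction rule: polys_induct)
  case (add f g)
  then have "(dd f + dd g) * d = (f + g) - psubst \<sigma> (f + g)"
    by (simp add: psubst_add distrib_right)
  with add dd_eqI[OF this] show ?case by simp
next
  case (pvar l f)
  then have *: "(pvar l * dd f + c l * psubst \<sigma> f) * d = pvar l * f - psubst \<sigma> (pvar l * f)"
    by (intro twisted_leibniz) auto
  moreover have "pvar l * dd f + c l * psubst \<sigma> f \<in> polys n"
    using pvar by (auto intro!: polys_add polys_mult psubst_polys \<sigma>_polys c_polys)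
  ultimately show ?case using dd_eqI[OF *] by simp
qed simp

lemma dd_add: "f \<in> polys n \<Longrightarrow> g \<in> polys n \<Longrightarrow> dd (f + g) = dd f + dd g"
  by (rule dd_eqI) (simp add: distrib_right dd_works psubst_add)

lemma dd_pvar_mult:
  assumes "l \<in> {1..n}" "f \<in> polys n"
  shows "dd (pvar l * f) = pvar l * dd f + c l * psubst \<sigma> f"
  using assms by (intro dd_eqI twisted_leibniz) (simp_all add: dd_works)

end

lemma single_one_eq_iff: "Poly_Mapping.single i (1::nat) = Poly_Mapping.single k 1 \<longleftrightarrow> i = k"
  by (metis keys_single one_neq_zero singleton_inject)

lemma pvar_eq_iff [simp]: "pvar i = pvar k \<longleftrightarrow> i = k"
  unfolding pvar_def by (metis keys_single single_one_eq_iff one_neq_zero singleton_inject)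

text \<open>The coefficient at y_i is 1, since y_k is another monomial.\<close>

lemma pvar_add_nonzero: "i \<noteq> k \<Longrightarrow> pvar i + pvar k \<noteq> 0"
proof
  assume "i \<noteq> k" "pvar i + pvar k = 0"
  then have "Poly_Mapping.lookup (pvar i + pvar k) (Poly_Mapping.single i 1) = 0"
    by simp
  with \<open>i \<noteq> k\<close> show False
    by (simp add: lookup_add pvar_def lookup_single when_def single_one_eq_iff del: One_nat_def)
qed

section \<open>Commutation relations in the Hecke algebra\<close>

lemma poly_y_single:
  "poly_y n (Poly_Mapping.single m c) =
    Poly_Mapping.single (concat (map (\<lambda>i. replicate (Poly_Mapping.lookup m i) (Y i)) [1..<Suc n])) c"
  by (simp add: poly_y_def)

lemma poly_y_0 [simp]: "poly_y n 0 = 0"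
  by (simp add: poly_y_def)

lemma poly_y_add: "poly_y n (f + g) = poly_y n f + poly_y n g"
  unfolding poly_y_def by (rule setsum_keys_plus_distrib) (simp_all add: single_add)

lemma poly_y_uminus: "poly_y n (- f) = - poly_y n f"
  using poly_y_add[of n f "- f"] by (simp add: eq_neg_iff_add_eq_0 add.commute)

lemma poly_y_const [simp]: "poly_y n (const c) = scalar c"
proof -
  have "concat (map (\<lambda>i. replicate (Poly_Mapping.lookup 0 i) (Y i)) [1..<Suc n]) = []"
    by simp
  then show ?thesis by (simp only: poly_y_single)
qed

lemma scalar_1 [simp]: "scalar 1 = 1"
  using single_one[where 'a = "'a list"] by (simp only: zero_list_def)

lemma poly_y_1 [simp]: "poly_y n 1 = 1"
  using poly_y_const[of n 1] by simp

lemma spinW_gens_subset: "spinW_gens n \<subseteq> daha_gens n"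
  by (auto simp: spinW_gens_def daha_gens_def)

lemma free_alg_gen_t [simp]: "i \<in> {1..n} \<Longrightarrow> gen_t i \<in> carrier (free_alg (spinW_gens n))"
  by (intro free_alg_single) (auto simp: spinW_gens_def)

lemma free_alg_t_up [simp]: "1 \<le> i \<Longrightarrow> j \<le> n \<Longrightarrow> t_up i j \<in> carrier (free_alg (spinW_gens n))"
  unfolding t_up_def by (rule free_alg_prod_list) (auto intro!: free_alg_gen_t)

lemma free_alg_t_down [simp]: "1 \<le> j \<Longrightarrow> i \<le> n \<Longrightarrow> t_down i j \<in> carrier (free_alg (spinW_gens n))"
  unfolding t_down_def by (rule free_alg_prod_list) (auto intro!: free_alg_gen_t)

lemma free_alg_brack [simp]:
  "i \<in> {1..n} \<Longrightarrow> j \<in> {1..n} \<Longrightarrow> brack i j \<in> carrier (free_alg (spinW_gens n))"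
  by (auto simp: brack_def brack_lt_def intro!: free_alg_mult free_alg_power)

lemma free_alg_brackbar [simp]:
  "i \<in> {1..n} \<Longrightarrow> j \<in> {1..n} \<Longrightarrow> brackbar n i j \<in> carrier (free_alg (spinW_gens n))"
  by (auto simp: brackbar_def brackbar_lt_def intro!: free_alg_mult free_alg_power)

lemma brack_swap: "i \<noteq> j \<Longrightarrow> brack j i = - brack i j"
  by (auto simp: brack_def)

lemma brackbar_swap: "brackbar n j i = brackbar n i j"
  by (auto simp: brackbar_def dest: less_antisym)

lemma spinW_rels_closed: "3 \<le> n \<Longrightarrow> spinW_rels n \<subseteq> carrier (free_alg (spinW_gens n))"
  unfolding spinW_rels_def
  by (auto intro!: free_alg_add free_alg_diff free_alg_mult free_alg_power free_alg_gen_t)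

lemma daha_rels_memb:
  "i \<in> {1..n} \<Longrightarrow> j \<in> {1..n} \<Longrightarrow> gen_y i * gen_y j - gen_y j * gen_y i \<in> daha_rels n u"
  "i \<in> {1..n - 1} \<Longrightarrow> gen_t i * gen_y i - gen_y (i + 1) * gen_t i \<in> daha_rels n u"
  "i \<in> {1..n - 1} \<Longrightarrow> j \<in> {1..n} \<Longrightarrow> j \<noteq> i \<Longrightarrow> j \<noteq> i + 1 \<Longrightarrow>
    gen_t i * gen_y j - gen_y j * gen_t i \<in> daha_rels n u"
  "gen_t n * gen_y n + gen_y (n - 1) * gen_t n \<in> daha_rels n u"
  "j \<in> {1..n} \<Longrightarrow> j \<noteq> n - 1 \<Longrightarrow> j \<noteq> n \<Longrightarrow> gen_t n * gen_y j - gen_y j * gen_t n \<in> daha_rels n u"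
  "i \<in> {1..n} \<Longrightarrow> gen_t i * gen_t i - 1 \<in> daha_rels n u"
  "i \<in> {1..n} \<Longrightarrow> j \<in> {1..n} \<Longrightarrow> i \<noteq> j \<Longrightarrow>
    gen_y j * gen_xi i - gen_xi i * gen_y j - (- (scalar u * brack i j) + scalar u * brackbar n i j) \<in> daha_rels n u"
  "i \<in> {1..n} \<Longrightarrow> gen_y i * gen_xi i - gen_xi i * gen_y i
    - scalar u * (\<Sum>k\<in>{1..n} - {i}. brack i k + brackbar n i k) \<in> daha_rels n u"
  \<comment> \<open>The family is selected by hand: search over all of them has the simplifier expand products
    of words, which does not end.\<close>
  apply (unfold daha_rels_def)[1]
  apply (rule UnI1, rule UnI1, rule UnI1, rule UnI1, rule UnI1, rule UnI1, rule UnI1, rule UnI1, rule UnI1, rule UnI1, rule UnI1, rule UnI2, rule CollectI, rule exI, rule exI, (rule conjI), rule refl, (intro conjI)?, assumption+)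
  apply (unfold daha_rels_def)[1]
  apply (rule UnI1, rule UnI1, rule UnI1, rule UnI1, rule UnI1, rule UnI1, rule UnI1, rule UnI1, rule UnI1, rule UnI2, rule CollectI, rule exI, (rule conjI), rule refl, (intro conjI)?, assumption+)
  apply (unfold daha_rels_def)[1]
  apply (rule UnI1, rule UnI1, rule UnI1, rule UnI1, rule UnI1, rule UnI1, rule UnI1, rule UnI2, rule CollectI, rule exI, rule exI, (rule conjI), rule refl, (intro conjI)?, assumption+)
  apply (unfold daha_rels_def)[1]
  apply (rule UnI1, rule UnI1, rule UnI1, rule UnI1, rule UnI1, rule UnI2, rule singletonI)
  apply (unfold daha_rels_def)[1]
  apply (rule UnI1, rule UnI1, rule UnI1, rule UnI2, rule CollectI, rule exI, (rule conjI), rule refl, (intro conjI)?, assumption+)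
  apply (unfold daha_rels_def)[1]
  apply (rule UnI1, rule UnI1, rule UnI1, rule UnI1, rule UnI1, rule UnI1, rule UnI1, rule UnI1, rule UnI1, rule UnI1, rule UnI1, rule UnI1, unfold spinW_rels_def, rule UnI1, rule UnI1, rule UnI1, rule UnI1, rule CollectI, rule exI, rule conjI, rule refl, assumption)
  apply (unfold daha_rels_def)[1]
  apply (rule UnI1, rule UnI2, rule CollectI, rule exI, rule exI, (rule conjI), rule refl, (intro conjI)?, assumption+)
  apply (unfold daha_rels_def)[1]
  apply (rule UnI2, rule CollectI, rule exI, (rule conjI), rule refl, (intro conjI)?, assumption+)
  done

text \<open>The bound makes \<open>n - 2\<close> at least 1; with truncated subtraction the relation
  between t_{n-2} and t_n would otherwise contain the letter \<open>T 0\<close>, which is not a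
  generator.\<close>

locale hecke =
  fixes n :: nat and u :: complex
  assumes n: "3 \<le> n"
begin

abbreviation (input) "H \<equiv> carrier (free_alg (daha_gens n))"

lemma spin_H: "p \<in> carrier (free_alg (spinW_gens n)) \<Longrightarrow> p \<in> H"
  using free_alg_mono[OF spinW_gens_subset] by blast

lemma H_gens [simp]:
  "i \<in> {1..n} \<Longrightarrow> gen_xi i \<in> H" "i \<in> {1..n} \<Longrightarrow> gen_y i \<in> H" "i \<in> {1..n} \<Longrightarrow> gen_t i \<in> H"
  "scalar c \<in> H"
  by (intro free_alg_single; simp add: daha_gens_def)+

lemma H_brackets [simp]:
  "i \<in> {1..n} \<Longrightarrow> j \<in> {1..n} \<Longrightarrow> brack i j \<in> H"
  "i \<in> {1..n} \<Longrightarrow> j \<in> {1..n} \<Longrightarrow> brackbar n i j \<in> H"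
  by (intro spin_H free_alg_brack free_alg_brackbar; assumption)+

lemma rels_H: "daha_rels n u \<subseteq> H"
proof -
  have "spinW_rels n \<subseteq> H"
    using spinW_rels_closed[OF n] spin_H by blast
  then show ?thesis
    using n unfolding daha_rels_def
    by (auto intro!: free_alg_add free_alg_diff free_alg_mult free_alg_sum H_gens H_brackets)
qed

sublocale presentation "daha_gens n" "daha_rels n u"
  by unfold_locales (rule rels_H)

abbreviation eqvH :: "falg \<Rightarrow> falg \<Rightarrow> bool" (infix \<open>\<sim>\<close> 50) where
  "p \<sim> q \<equiv> eqv p q"

section \<open>Polynomials in the y's as elements of H\<close>

lemma poly_y_H [simp]: "poly_y n f \<in> H"
  \<comment> \<open>The words run over the indices 1 to n, so they consist of generators of H
    whatever variables \<open>f\<close> contains.\<close>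
  unfolding poly_y_def
  by (intro free_alg_sum free_alg_single) (auto simp: daha_gens_def)

lemma y_commute: "i \<in> {1..n} \<Longrightarrow> j \<in> {1..n} \<Longrightarrow> gen_y i * gen_y j \<sim> gen_y j * gen_y i"
  by (intro eqv_rel daha_rels_memb free_alg_mult H_gens)

lemma single_Cons: "Poly_Mapping.single (a # w) c = word [a] * Poly_Mapping.single w c"
  by (simp add: mult_single plus_list_def)

text \<open>The letter passes only over the prefix, so it is the prefix that must consist of y's;
  the suffix may be any word.\<close>

lemma move_y_front:
  assumes "l \<in> {1..n}" "set w \<subseteq> Y ` {1..n}" "set w' \<subseteq> daha_gens n"
  shows "Poly_Mapping.single (w @ Y l # w') c \<sim> gen_y l * Poly_Mapping.single (w @ w') c"
  using assms(2)
proof (induction w)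
  case Nil
  have "gen_y l * Poly_Mapping.single w' c \<in> H"
    using assms by (intro free_alg_mult free_alg_single H_gens)
  then show ?case
    unfolding append_Nil single_Cons[of "Y l" w'] by (rule eqv_refl)
next
  case (Cons a w)
  then obtain j where j: "a = Y j" "j \<in> {1..n}"
    by auto
  let ?p = "Poly_Mapping.single (w @ w') c"
  have p: "?p \<in> H"
    using Cons.prems assms by (intro free_alg_single) (auto simp: daha_gens_def)
  have "Poly_Mapping.single ((a # w) @ Y l # w') c = gen_y j * Poly_Mapping.single (w @ Y l # w') c"
    by (simp add: j(1) flip: single_Cons)
  also have "\<dots> \<sim> gen_y j * (gen_y l * ?p)"
    using Cons j by (intro eqv_mult_left) auto
  also have "gen_y j * (gen_y l * ?p) = (gen_y j * gen_y l) * ?p"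
    by (simp only: mult.assoc)
  also have "\<dots> \<sim> (gen_y l * gen_y j) * ?p"
    using j assms p by (intro eqv_mult_right y_commute)
  also have "\<dots> = gen_y l * Poly_Mapping.single ((a # w) @ w') c"
    by (simp only: j(1) mult.assoc append_Cons single_Cons[of "Y j" "w @ w'" c])
  finally show ?case .
qed

text \<open>Words are sorted, so the additional y_l appears in the middle of the word, at the head
  of the block of y_l's, and has to be brought to the front.\<close>

lemma poly_y_pvar_mult:
  assumes l: "l \<in> {1..n}"
  shows "poly_y n (pvar l * f) \<sim> gen_y l * poly_y n f"
proof (induction f rule: poly_mapping_add_induct)
  case (single m c)
  let ?w = "\<lambda>m is. concat (map (\<lambda>i. replicate (Poly_Mapping.lookup m i) (Y i)) is)"
  let ?m = "Poly_Mapping.single l 1 + m"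
  have split: "[1..<Suc n] = [1..<l] @ l # [Suc l..<Suc n]"
    using l upt_add_eq_append[of 1 l "Suc n - l"] upt_conv_Cons[of l "Suc n"] by (simp del: upt_Suc)
  have same: "?w ?m is = ?w m is" if "l \<notin> set is" for "is"
    using that by (intro arg_cong[where f = concat] map_cong) (auto simp: lookup_add lookup_single when_def)
  have 1: "?w ?m [1..<Suc n] = ?w m [1..<l] @ Y l # (replicate (Poly_Mapping.lookup m l) (Y l) @ ?w m [Suc l..<Suc n])"
    unfolding split map_append concat_append list.map concat.simps
    by (subst (1 2) same) (simp_all add: lookup_add)
  have 2: "?w m [1..<Suc n] = ?w m [1..<l] @ (replicate (Poly_Mapping.lookup m l) (Y l) @ ?w m [Suc l..<Suc n])"
    unfolding split by simp
  show ?case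
    unfolding pvar_mult_single poly_y_single 1 unfolding 2
    using l by (intro move_y_front) (auto simp: daha_gens_def)
next
  case (add f g)
  then show ?case
    by (simp add: distrib_left poly_y_add eqv_add)
qed

lemma poly_y_pvar: "l \<in> {1..n} \<Longrightarrow> poly_y n (pvar l) \<sim> gen_y l"
  using poly_y_pvar_mult[of l 1] by simp

lemma poly_y_mult:
  assumes "f \<in> polys n"
  shows "poly_y n (f * g) \<sim> poly_y n f * poly_y n g"
  using assms
proof (induction rule: polys_induct)
  case (const c)
  show ?case
  proof (induction g rule: poly_mapping_add_induct)
    case (single m d)
    have "poly_y n (const c * Poly_Mapping.single m d) = poly_y n (const c) * poly_y n (Poly_Mapping.single m d)"
      by (subst poly_y_const) (simp only: mult_single add_0 poly_y_single plus_list_def append_Nil)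
    then show ?case
      using eqv_refl[of "poly_y n (const c * Poly_Mapping.single m d)"] by (simp only: poly_y_H free_alg_mult)
  next
    case (add f g)
    then show ?case
      by (simp add: distrib_left poly_y_add eqv_add)
  qed
next
  case (add f f')
  then show ?case
    by (simp add: distrib_right poly_y_add eqv_add)
next
  case (pvar l f)
  have "poly_y n (pvar l * f * g) \<sim> gen_y l * poly_y n (f * g)"
    using poly_y_pvar_mult[OF pvar(1), of "f * g"] by (simp only: mult.assoc)
  also have "\<dots> \<sim> gen_y l * (poly_y n f * poly_y n g)"
    using pvar by (intro eqv_mult_left) auto
  also have "\<dots> = (gen_y l * poly_y n f) * poly_y n g"
    by (simp only: mult.assoc)
  also have "\<dots> \<sim> poly_y n (pvar l * f) * poly_y n g"
    using pvar by (intro eqv_mult_right eqv_sym[OF poly_y_pvar_mult]) auto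
  finally show ?case .
qed

text \<open>Conjugation by \<open>x\<close> takes \<open>f\<close> to \<open>g\<close>, written
  without an inverse. In this form it composes along products of letters and does not see the sign
  of \<open>x\<close>.\<close>

definition moves :: "falg \<Rightarrow> mpoly \<Rightarrow> mpoly \<Rightarrow> bool" where
  "moves x f g \<longleftrightarrow> x \<in> H \<and> x * poly_y n f \<sim> poly_y n g * x"

lemma moves_comp: "moves y f g \<Longrightarrow> moves x g h \<Longrightarrow> moves (x * y) f h"
  unfolding moves_def
proof (elim conjE, intro conjI)
  assume *: "x \<in> H" "y \<in> H" "y * poly_y n f \<sim> poly_y n g * y" "x * poly_y n g \<sim> poly_y n h * x"
  then show "x * y \<in> H" by simp
  have "x * (y * poly_y n f) \<sim> x * (poly_y n g * y)"
    using * by (intro eqv_mult_left)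
  moreover have "(x * poly_y n g) * y \<sim> (poly_y n h * x) * y"
    using * by (intro eqv_mult_right)
  ultimately show "x * y * poly_y n f \<sim> poly_y n h * (x * y)"
    using eqv_trans by (simp only: mult.assoc)
qed

lemma moves_uminus: "moves x f g \<Longrightarrow> moves x (- f) (- g)"
  by (auto simp: moves_def poly_y_uminus dest: eqv_uminus)

lemma moves_uminus_left: "moves x f g \<Longrightarrow> moves (- x) f g"
  by (auto simp: moves_def dest: eqv_uminus)

lemma moves_sign: "moves x f g \<Longrightarrow> moves ((- 1) ^ k * x) f g"
  by (induction k) (auto dest: moves_uminus_left)

lemma moves_1 [simp]: "moves 1 f f"
  by (simp add: moves_def)

text \<open>The chain is \<open>x g = x g x x = x x f x = f x\<close>. It supplies the effect of t_i
  on the second variable that it exchanges, the relations giving only the first.\<close>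

lemma moves_inverse:
  assumes "moves x f g" "x * x \<sim> 1"
  shows "moves x g f"
proof -
  from assms have x: "x \<in> H" and xfg: "x * poly_y n f \<sim> poly_y n g * x"
    by (auto simp: moves_def)
  have "x * poly_y n g = x * poly_y n g * 1"
    by simp
  also have "\<dots> \<sim> x * poly_y n g * (x * x)"
    using x by (intro eqv_mult_left eqv_sym[OF assms(2)]) simp
  also have "\<dots> = x * (poly_y n g * x) * x"
    by (simp only: mult.assoc)
  also have "\<dots> \<sim> x * (x * poly_y n f) * x"
    using x by (intro eqv_mult_right eqv_mult_left eqv_sym[OF xfg])
  also have "\<dots> = (x * x) * (poly_y n f * x)"
    by (simp only: mult.assoc)
  also have "\<dots> \<sim> 1 * (poly_y n f * x)"
    using x by (intro eqv_mult_right assms(2)) simp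
  finally show ?thesis
    using x by (simp add: moves_def)
qed

text \<open>Passing \<open>x\<close> over a product multiplies the images of the factors, and
  \<open>psubst\<close> obeys the same rule, so the variables determine everything; scalars commute
  with \<open>x\<close>.\<close>

lemma moves_psubst:
  assumes "f \<in> polys n" and x: "x \<in> H"
    and \<sigma>: "\<And>l. l \<in> {1..n} \<Longrightarrow> \<sigma> l \<in> polys n" "\<And>l. l \<in> {1..n} \<Longrightarrow> moves x (pvar l) (\<sigma> l)"
  shows "x * poly_y n f \<sim> poly_y n (psubst \<sigma> f) * x"
  using assms(1)
proof (induction rule: polys_induct)
  case (const c)
  then show ?case
    using x by (simp add: eqv_refl scalar_commute[of c x])
next
  case (add f g)
  then show ?case
    by (simp add: poly_y_add psubst_add distrib_left distrib_right eqv_add)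
next
  case (pvar l f)
  let ?f = "poly_y n f" and ?g = "poly_y n (psubst \<sigma> f)"
  have "x * poly_y n (pvar l * f) \<sim> x * (poly_y n (pvar l) * ?f)"
    using x pvar by (intro eqv_mult_left poly_y_mult) auto
  also have "\<dots> = (x * poly_y n (pvar l)) * ?f"
    by (simp only: mult.assoc)
  also have "\<dots> \<sim> (poly_y n (\<sigma> l) * x) * ?f"
    using \<sigma>(2)[of l] pvar by (intro eqv_mult_right) (auto simp: moves_def)
  also have "\<dots> = poly_y n (\<sigma> l) * (x * ?f)"
    by (simp only: mult.assoc)
  also have "\<dots> \<sim> poly_y n (\<sigma> l) * (?g * x)"
    using pvar by (intro eqv_mult_left) auto
  also have "\<dots> = (poly_y n (\<sigma> l) * ?g) * x"
    by (simp only: mult.assoc)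
  also have "\<dots> \<sim> poly_y n (\<sigma> l * psubst \<sigma> f) * x"
    using x \<sigma>(1) pvar by (intro eqv_mult_right eqv_sym[OF poly_y_mult]) auto
  finally show ?case
    by (simp only: psubst_pvar_mult)
qed

section \<open>Conjugation by the generators t_i\<close>

lemma movesI:
  assumes "i \<in> {1..n}" "l \<in> {1..n}" "l' \<in> {1..n}" "gen_t i * gen_y l - gen_y l' * gen_t i \<in> daha_rels n u"
  shows "moves (gen_t i) (pvar l) (pvar l')"
proof -
  have "gen_t i * poly_y n (pvar l) \<sim> gen_t i * gen_y l"
    using assms by (intro eqv_mult_left poly_y_pvar) auto
  also have "\<dots> \<sim> gen_y l' * gen_t i"
    using assms by (intro eqv_rel) auto
  also have "\<dots> \<sim> poly_y n (pvar l') * gen_t i"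
    using assms by (intro eqv_mult_right eqv_sym[OF poly_y_pvar]) auto
  finally show ?thesis
    using assms by (simp add: moves_def)
qed

lemma moves_minusI:
  assumes "i \<in> {1..n}" "l \<in> {1..n}" "l' \<in> {1..n}" "gen_t i * gen_y l + gen_y l' * gen_t i \<in> daha_rels n u"
  shows "moves (gen_t i) (pvar l) (- pvar l')"
proof -
  have "gen_t i * poly_y n (pvar l) \<sim> gen_t i * gen_y l"
    using assms by (intro eqv_mult_left poly_y_pvar) auto
  also have "\<dots> \<sim> - (gen_y l' * gen_t i)"
    using assms by (intro eqv_rel) auto
  also have "\<dots> \<sim> - (poly_y n (pvar l') * gen_t i)"
    using assms by (intro eqv_uminus eqv_mult_right eqv_sym[OF poly_y_pvar]) auto
  finally show ?thesis
    using assms by (simp add: moves_def poly_y_uminus)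
qed

lemma t_square: "i \<in> {1..n} \<Longrightarrow> gen_t i * gen_t i \<sim> 1"
  by (intro eqv_rel daha_rels_memb free_alg_mult H_gens free_alg_1)

lemma moves_t:
  assumes "1 \<le> i" "i < n" "l \<in> {1..n}"
  shows "moves (gen_t i) (pvar l) (refl_s i (i + 1) l)"
proof -
  have *: "moves (gen_t i) (pvar i) (pvar (i + 1))"
    using assms by (intro movesI daha_rels_memb) auto
  consider "l = i" | "l = i + 1" | "l \<noteq> i" "l \<noteq> i + 1" by blast
  then show ?thesis
  proof cases
    case 1
    with * show ?thesis by (simp add: refl_s_def)
  next
    case 2
    then show ?thesis
      using moves_inverse[OF * t_square] assms by (simp add: refl_s_def)
  next
    case 3
    then have "gen_t i * gen_y l - gen_y l * gen_t i \<in> daha_rels n u"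
      using assms by (intro daha_rels_memb) auto
    with 3 show ?thesis
      using assms by (auto simp: refl_s_def intro!: movesI)
  qed
qed

lemma moves_t_n:
  assumes "l \<in> {1..n}"
  shows "moves (gen_t n) (pvar l) (refl_sbar (n - 1) n l)"
proof -
  have *: "moves (gen_t n) (pvar n) (- pvar (n - 1))"
    using n by (intro moves_minusI daha_rels_memb) auto
  consider "l = n" | "l = n - 1" | "l \<noteq> n" "l \<noteq> n - 1" by blast
  then show ?thesis
  proof cases
    case 1
    with * n show ?thesis by (auto simp: refl_sbar_def)
  next
    case 2
    \<comment> \<open>Inversion leaves the sign on the source; negating both polynomials then shifts
      it to the target.\<close>
    have "moves (gen_t n) (- pvar (n - 1)) (pvar n)"
      using n by (intro moves_inverse[OF * t_square]) auto
    then show ?thesis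
      using moves_uminus[of _ "- pvar (n - 1)" "pvar n"] 2 by (simp add: refl_sbar_def)
  next
    case 3
    then have "gen_t n * gen_y l - gen_y l * gen_t n \<in> daha_rels n u"
      using assms by (intro daha_rels_memb) auto
    with 3 show ?thesis
      using assms by (auto simp: refl_sbar_def intro!: movesI)
  qed
qed

text \<open>The cycles induced on indices by \<open>t\<^sub>a \<cdots> t\<^sub>b\<^sub>-\<^sub>1\<close> and \<open>t\<^sub>b\<^sub>-\<^sub>1 \<cdots> t\<^sub>a\<close>.\<close>

definition up :: "nat \<Rightarrow> nat \<Rightarrow> nat \<Rightarrow> nat" where
  "up a b l = (if l = b then a else if a \<le> l \<and> l < b then l + 1 else l)"

definition down :: "nat \<Rightarrow> nat \<Rightarrow> nat \<Rightarrow> nat" where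
  "down a b l = (if l = a then b else if a < l \<and> l \<le> b then l - 1 else l)"

text \<open>The last letter t_b meets the variable first, so the induction hypothesis is applied to
  the index that t_b has already changed; hence the generalization over \<open>l\<close>.\<close>

lemma moves_up:
  assumes "1 \<le> a" "a \<le> b" "b \<le> n" "l \<in> {1..n}"
  shows "moves (prod_list (map gen_t [a..<b])) (pvar l) (pvar (up a b l))"
  using assms(2-4)
proof (induction b arbitrary: l rule: dec_induct)
  case base
  then show ?case by (auto simp: up_def)
next
  case (step b)
  define l' where "l' = (if l = b then b + 1 else if l = b + 1 then b else l)"
  have "moves (gen_t b) (pvar l) (pvar l')"
    using moves_t[of b l] step assms(1) by (auto simp: refl_s_def l'_def split: if_splits)
  moreover have "moves (prod_list (map gen_t [a..<b])) (pvar l') (pvar (up a b l'))"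
    using step assms(1) by (intro step.IH) (auto simp: l'_def)
  moreover have "up a b l' = up a (Suc b) l"
    using step by (auto simp: up_def l'_def)
  ultimately show ?case
    using step moves_comp by fastforce
qed

text \<open>In the reversed product t_b stands leftmost and acts last, on the index that the shorter
  cycle has produced.\<close>

lemma moves_down:
  assumes "1 \<le> a" "a \<le> b" "b \<le> n" "l \<in> {1..n}"
  shows "moves (prod_list (map gen_t (rev [a..<b]))) (pvar l) (pvar (down a b l))"
  using assms(2-4)
proof (induction b arbitrary: l rule: dec_induct)
  case base
  then show ?case by (auto simp: down_def)
next
  case (step b)
  have "down a b l \<in> {1..n}"
    using step assms(1) by (auto simp: down_def)
  then have "moves (gen_t b) (pvar (down a b l)) (refl_s b (b + 1) (down a b l))"
    using step assms(1) by (intro moves_t) auto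
  moreover have "refl_s b (b + 1) (down a b l) = pvar (down a (Suc b) l)"
    using step by (auto simp: down_def refl_s_def)
  moreover have "moves (prod_list (map gen_t (rev [a..<b]))) (pvar l) (pvar (down a b l))"
    using step by (intro step.IH) auto
  ultimately show ?case
    using step moves_comp by fastforce
qed

section \<open>Conjugation by the brackets\<close>

lemma moves_brack_lt:
  assumes "1 \<le> i" "i < j" "j \<le> n" "l \<in> {1..n}"
  shows "moves (brack_lt i j) (pvar l) (refl_s i j l)"
proof -
  \<comment> \<open>The right factor takes y_j to y_{i+1}, then t_i exchanges y_i and y_{i+1}, and
    the left factor undoes the first cycle: s_ij is a conjugate of s_i.\<close>
  define l1 where "l1 = up (i + 1) j l"
  define l2 where "l2 = (if l1 = i then i + 1 else if l1 = i + 1 then i else l1)"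
  have "moves (t_up (i + 1) (j - 1)) (pvar l) (pvar l1)"
    using moves_up[of "i + 1" j l] assms by (simp add: t_up_def l1_def)
  moreover have l1: "l1 \<in> {1..n}"
    using assms by (auto simp: l1_def up_def)
  then have "moves (gen_t i) (pvar l1) (pvar l2)"
    using moves_t[of i l1] assms by (auto simp: refl_s_def l2_def split: if_splits)
  moreover have "l2 \<in> {1..n}"
    using assms l1 by (auto simp: l2_def)
  then have "moves (t_down (j - 1) (i + 1)) (pvar l2) (pvar (down (i + 1) j l2))"
    using moves_down[of "i + 1" j l2] assms by (simp add: t_down_def)
  moreover have "pvar (down (i + 1) j l2) = refl_s i j l"
    using assms by (auto simp: refl_s_def l2_def l1_def up_def down_def)
  ultimately show ?thesis
    unfolding brack_lt_def mult.assoc using moves_comp moves_sign by metis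
qed

lemma moves_brack:
  assumes "i \<in> {1..n}" "j \<in> {1..n}" "i \<noteq> j" "l \<in> {1..n}"
  shows "moves (brack i j) (pvar l) (refl_s i j l)"
proof (cases "i < j")
  case True
  then show ?thesis using assms moves_brack_lt by (simp add: brack_def)
next
  case False
  moreover have "refl_s i j l = refl_s j i l"
    by (auto simp: refl_s_def)
  ultimately show ?thesis
    using assms moves_uminus_left[OF moves_brack_lt[of j i l]] by (simp add: brack_def)
qed

text \<open>A conjugate of t_n: the two descending products carry y_j to y_n and y_i to y_{n-1},
  where t_n acts as the barred reflection, and the two ascending products carry them back.\<close>

lemma moves_brackbar_lt:
  assumes "1 \<le> i" "i < j" "j \<le> n" "l \<in> {1..n}"
  shows "moves (brackbar_lt n i j) (pvar l) (refl_sbar i j l)"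
proof -
  \<comment> \<open>\<open>t_up\<close> and \<open>t_down\<close> have inclusive ranges, the cycles
    half-open ones, so the upper end grows by one; \<open>Suc (n - 2) = n - 1\<close> uses the bound
    on \<open>n\<close>.\<close>
  have t_up: "t_up j (n - 1) = prod_list (map gen_t [j..<n])"
      "t_up i (n - 2) = prod_list (map gen_t [i..<n - 1])"
    and t_down: "t_down (n - 1) j = prod_list (map gen_t (rev [j..<n]))"
      "t_down (n - 2) i = prod_list (map gen_t (rev [i..<n - 1]))"
    using n Suc_diff_Suc[of 1 n] by (simp_all add: t_up_def t_down_def numeral_2_eq_2)
  define l1 where "l1 = down j n l"
  define l2 where "l2 = down i (n - 1) l1"
  have l1: "l1 \<in> {1..n}"
    using assms by (auto simp: l1_def down_def)
  have l2: "l2 \<in> {1..n}"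
    using assms l1 by (auto simp: l2_def down_def)
  have 1: "moves (t_down (n - 1) j) (pvar l) (pvar l1)"
    unfolding t_down l1_def using assms by (intro moves_down) auto
  have 2: "moves (t_down (n - 2) i) (pvar l1) (pvar l2)"
    unfolding t_down l2_def using assms l1 by (intro moves_down) auto
  have 3: "moves (gen_t n) (pvar l2) (refl_sbar (n - 1) n l2)"
    by (rule moves_t_n[OF l2])
  have 4: "moves (t_up j (n - 1) * t_up i (n - 2)) (pvar m) (pvar (up j n (up i (n - 1) m)))"
    if "m \<in> {1..n}" for m
    unfolding t_up using that assms
    by (intro moves_comp[OF moves_up moves_up]) (auto simp: up_def)
  have "moves (t_up j (n - 1) * t_up i (n - 2)) (refl_sbar (n - 1) n l2) (refl_sbar i j l)"
  proof (cases "l = i \<or> l = j")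
    case True
    then consider "l = i" "l2 = n - 1" | "l = j" "l2 = n"
      using assms by (auto simp: l2_def l1_def down_def)
    then show ?thesis
    proof cases
      case 1
      have "up j n (up i (n - 1) n) = j"
        using n by (auto simp: up_def)
      then show ?thesis
        using 1 n moves_uminus[OF 4[of n]] by (simp add: refl_sbar_def)
    next
      case 2
      have "up j n (up i (n - 1) (n - 1)) = i"
        using n assms by (auto simp: up_def)
      then show ?thesis
        using 2 n assms moves_uminus[OF 4[of "n - 1"]] by (auto simp: refl_sbar_def)
    qed
  next
    case False
    \<comment> \<open>An index other than i and j is lowered once for each of i and j lying below
      it. It then avoids the two places where t_n acts, and the ascending cycles restore it.\<close>
    then have "l < i \<or> i < l \<and> l < j \<or> j < l"
      by linarith
    then have "l < i \<and> l2 = l \<or> i < l \<and> l < j \<and> l2 = l - 1 \<or> j < l \<and> l2 = l - 2"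
      using assms by (elim disjE) (simp_all add: l1_def l2_def down_def, auto)
    then have "l2 \<noteq> n \<and> l2 \<noteq> n - 1 \<and> up j n (up i (n - 1) l2) = l"
      using assms by (elim disjE conjE) (auto simp: up_def)
    then show ?thesis
      using False 4[OF l2] by (simp add: refl_sbar_def)
  qed
  from moves_comp[OF moves_comp[OF moves_comp[OF 1 2] 3] this] show ?thesis
    unfolding brackbar_lt_def mult.assoc by (intro moves_sign)
qed

lemma moves_brackbar:
  assumes "i \<in> {1..n}" "j \<in> {1..n}" "i \<noteq> j" "l \<in> {1..n}"
  shows "moves (brackbar n i j) (pvar l) (refl_sbar i j l)"
proof (cases "i < j")
  case True
  then show ?thesis using assms moves_brackbar_lt by (simp add: brackbar_def)
next
  case False
  moreover have "refl_sbar i j l = refl_sbar j i l"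
    by (auto simp: refl_sbar_def)
  ultimately show ?thesis
    using assms moves_brackbar_lt[of j i l] by (simp add: brackbar_def)
qed

section \<open>The correction term when xi_i passes a polynomial\<close>

abbreviation (input) quot_s :: "nat \<Rightarrow> nat \<Rightarrow> mpoly \<Rightarrow> mpoly" where
  "quot_s i k \<equiv> divdiff (refl_s k i) (pvar i - pvar k)"

abbreviation (input) quot_sbar :: "nat \<Rightarrow> nat \<Rightarrow> mpoly \<Rightarrow> mpoly" where
  "quot_sbar i k \<equiv> divdiff (refl_sbar k i) (pvar i + pvar k)"

text \<open>The candidate for the commutator of xi_i with \<open>f\<close>, lifted to the free
  algebra. Its order of factors, polynomial before bracket, is what later lets the brackets be
  transferred to \<open>v\<close>.\<close>

definition dunkl :: "nat \<Rightarrow> mpoly \<Rightarrow> falg" where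
  "dunkl i f =
     scalar u * (\<Sum>k\<in>{1..n} - {i}. poly_y n (quot_s i k f) * brack k i) -
     scalar u * (\<Sum>k\<in>{1..n} - {i}. poly_y n (quot_sbar i k f) * brackbar n k i)"

text \<open>The divided differences of \<open>y\<^sub>l\<close>.\<close>

definition coeff_s :: "nat \<Rightarrow> nat \<Rightarrow> nat \<Rightarrow> mpoly" where
  "coeff_s i k l = (if l = i then 1 else if l = k then - 1 else 0)"

definition coeff_sbar :: "nat \<Rightarrow> nat \<Rightarrow> nat \<Rightarrow> mpoly" where
  "coeff_sbar i k l = (if l = i \<or> l = k then 1 else 0)"

text \<open>The correction term for \<open>f = y_l\<close>, with the quotients replaced by their
  explicit constant values so that it can be compared with the defining relations.\<close>

definition dunkl_pvar :: "nat \<Rightarrow> nat \<Rightarrow> falg" where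
  "dunkl_pvar i l =
     scalar u * (\<Sum>k\<in>{1..n} - {i}. poly_y n (coeff_s i k l) * brack k i) -
     scalar u * (\<Sum>k\<in>{1..n} - {i}. poly_y n (coeff_sbar i k l) * brackbar n k i)"

lemma dunkl_pvar_H [simp]: "i \<in> {1..n} \<Longrightarrow> dunkl_pvar i l \<in> H"
  unfolding dunkl_pvar_def
  by (intro free_alg_diff free_alg_mult free_alg_sum H_gens H_brackets poly_y_H) auto

lemma dunkl_H [simp]: "i \<in> {1..n} \<Longrightarrow> dunkl i f \<in> H"
  unfolding dunkl_def
  by (intro free_alg_diff free_alg_mult free_alg_sum H_gens H_brackets poly_y_H) auto

lemma divided_difference_s:
  "i \<in> {1..n} \<Longrightarrow> k \<in> {1..n} \<Longrightarrow> i \<noteq> k \<Longrightarrow>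
    divided_difference n (refl_s k i) (pvar i - pvar k) (coeff_s i k)"
  by unfold_locales (auto simp: refl_s_def coeff_s_def)

lemma divided_difference_sbar:
  "i \<in> {1..n} \<Longrightarrow> k \<in> {1..n} \<Longrightarrow> i \<noteq> k \<Longrightarrow>
    divided_difference n (refl_sbar k i) (pvar i + pvar k) (coeff_sbar i k)"
  by unfold_locales (auto simp: refl_sbar_def coeff_sbar_def pvar_add_nonzero)

text \<open>Both divided differences of y_i are 1. Antisymmetry turns [k,i] into -[i,k], while the
  barred bracket is symmetric and has the minus sign in front, so both sums end with the same
  sign.\<close>

lemma dunkl_pvar_diag:
  "dunkl_pvar i i = - (scalar u * (\<Sum>k\<in>{1..n} - {i}. brack i k + brackbar n i k))"
proof -
  have "(\<Sum>k\<in>{1..n} - {i}. poly_y n (coeff_s i k i) * brack k i) = - (\<Sum>k\<in>{1..n} - {i}. brack i k)"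
    unfolding sum_negf[symmetric]
    by (intro sum.cong) (auto simp: coeff_s_def brack_swap[of i])
  moreover have "(\<Sum>k\<in>{1..n} - {i}. poly_y n (coeff_sbar i k i) * brackbar n k i) = (\<Sum>k\<in>{1..n} - {i}. brackbar n i k)"
    by (intro sum.cong) (auto simp: coeff_sbar_def brackbar_swap)
  ultimately show ?thesis
    unfolding dunkl_pvar_def by (simp add: sum.distrib distrib_left)
qed

text \<open>Only \<open>k = l\<close> contributes; there the divided difference -1 is absorbed by
  antisymmetry, giving +[i,l].\<close>

lemma dunkl_pvar_offdiag:
  assumes "l \<in> {1..n}" "l \<noteq> i"
  shows "dunkl_pvar i l = scalar u * brack i l - scalar u * brackbar n i l"
proof -
  have "(\<Sum>k\<in>{1..n} - {i}. poly_y n (coeff_s i k l) * brack k i) =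
      (\<Sum>k\<in>{1..n} - {i}. if k = l then brack i l else 0)"
    using assms by (intro sum.cong) (auto simp: coeff_s_def brack_swap[of i] poly_y_uminus)
  moreover have "(\<Sum>k\<in>{1..n} - {i}. poly_y n (coeff_sbar i k l) * brackbar n k i) =
      (\<Sum>k\<in>{1..n} - {i}. if k = l then brackbar n i l else 0)"
    using assms by (intro sum.cong) (auto simp: coeff_sbar_def brackbar_swap)
  ultimately show ?thesis
    using assms unfolding dunkl_pvar_def by simp
qed

lemma xi_y:
  assumes "i \<in> {1..n}" "l \<in> {1..n}"
  shows "gen_xi i * gen_y l \<sim> gen_y l * gen_xi i + dunkl_pvar i l"
proof -
  have "gen_y l * gen_xi i - gen_xi i * gen_y l - (- dunkl_pvar i l) \<in> daha_rels n u"
  proof (cases "l = i")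
    case True
    then show ?thesis
      using daha_rels_memb(8)[OF assms(1), of u] by (simp only: dunkl_pvar_diag minus_minus)
  next
    case False
    then have "- dunkl_pvar i l = - (scalar u * brack i l) + scalar u * brackbar n i l"
      using dunkl_pvar_offdiag[OF assms(2)] by simp
    then show ?thesis
      using daha_rels_memb(7)[of i n l u] assms False by simp
  qed
  then have "gen_y l * gen_xi i - gen_xi i * gen_y l \<sim> - dunkl_pvar i l"
    using assms by (intro eqv_rel) auto
  from eqv_diff[OF eqv_refl this, of "gen_y l * gen_xi i"] assms show ?thesis
    by simp
qed

text \<open>The twisted Leibniz rule leaves \<sigma>(f) between the constant and the bracket
  \<open>x\<close>. Moving it across \<open>x\<close> turns it back into \<open>f\<close>, now on
  the far right, where it no longer depends on the reflection and can be taken out of the sum over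
  k.\<close>

lemma dd_step:
  assumes "divided_difference n \<sigma> d c" and x: "x \<in> H"
    and moves: "\<And>l. l \<in> {1..n} \<Longrightarrow> moves x (pvar l) (\<sigma> l)"
    and l: "l \<in> {1..n}" and f: "f \<in> polys n"
  shows "poly_y n (divdiff \<sigma> d (pvar l * f)) * x \<sim>
    gen_y l * (poly_y n (divdiff \<sigma> d f) * x) + (poly_y n (c l) * x) * poly_y n f"
proof -
  interpret divided_difference n \<sigma> d c by fact
  have "poly_y n (dd (pvar l * f)) * x =
      poly_y n (pvar l * dd f) * x + poly_y n (c l * psubst \<sigma> f) * x"
    using dd_pvar_mult[OF l f] by (simp add: poly_y_add distrib_right)
  also have "\<dots> \<sim> (gen_y l * poly_y n (dd f)) * x + (poly_y n (c l) * poly_y n (psubst \<sigma> f)) * x"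
    using x l c_polys by (intro eqv_add eqv_mult_right poly_y_pvar_mult poly_y_mult) auto
  also have "\<dots> = gen_y l * (poly_y n (dd f) * x) + poly_y n (c l) * (poly_y n (psubst \<sigma> f) * x)"
    by (simp only: mult.assoc)
  also have "\<dots> \<sim> gen_y l * (poly_y n (dd f) * x) + poly_y n (c l) * (x * poly_y n f)"
    using x l \<sigma>_polys moves
    by (intro eqv_add eqv_mult_left eqv_sym[OF moves_psubst[OF f x]] eqv_refl) auto
  finally show ?thesis
    by (simp only: mult.assoc)
qed

text \<open>The recursion that the commutator of xi_i with a polynomial satisfies when a variable is
  multiplied on the left, which is why the induction for \<open>xi_poly_y\<close> closes.\<close>

lemma dunkl_pvar_mult:
  assumes i: "i \<in> {1..n}" and l: "l \<in> {1..n}" and f: "f \<in> polys n"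
  shows "dunkl i (pvar l * f) \<sim> gen_y l * dunkl i f + dunkl_pvar i l * poly_y n f"
proof -
  let ?K = "{1..n} - {i}"
  have scalar: "scalar u * (gen_y l * p) = gen_y l * (scalar u * p)" for p
    by (simp only: scalar_commute[of u "gen_y l"] flip: mult.assoc)
  have "dunkl i (pvar l * f) \<sim>
    scalar u * (\<Sum>k\<in>?K. gen_y l * (poly_y n (quot_s i k f) * brack k i)
        + (poly_y n (coeff_s i k l) * brack k i) * poly_y n f) -
    scalar u * (\<Sum>k\<in>?K. gen_y l * (poly_y n (quot_sbar i k f) * brackbar n k i)
        + (poly_y n (coeff_sbar i k l) * brackbar n k i) * poly_y n f)"
    unfolding dunkl_def
    by (intro eqv_diff eqv_mult_left eqv_sum H_gens
        dd_step[OF divided_difference_s _ _ l f] dd_step[OF divided_difference_sbar _ _ l f])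
      (use i in \<open>auto intro: moves_brack moves_brackbar\<close>)
  also have "\<dots> = gen_y l * dunkl i f + dunkl_pvar i l * poly_y n f"
    unfolding dunkl_def dunkl_pvar_def sum.distrib
    by (simp only: distrib_left distrib_right right_diff_distrib left_diff_distrib scalar mult.assoc
        sum_distrib_right flip: sum_distrib_left) (simp add: algebra_simps)
  finally show ?thesis .
qed

lemma xi_poly_y:
  assumes i: "i \<in> {1..n}" and f: "f \<in> polys n"
  shows "gen_xi i * poly_y n f \<sim> poly_y n f * gen_xi i + dunkl i f"
  using f
proof (induction rule: polys_induct)
  case (const c)
  have "dunkl i (const c) = 0"
    unfolding dunkl_def
    using divided_difference.dd_const[OF divided_difference_s[OF i]]
      divided_difference.dd_const[OF divided_difference_sbar[OF i]]
    by (simp add: sum.neutral)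
  then show ?case
    using i by (simp add: eqv_refl scalar_commute[of c "gen_xi i"])
next
  case (add f g)
  have "dunkl i (f + g) = dunkl i f + dunkl i g"
    unfolding dunkl_def
    using divided_difference.dd_add[OF divided_difference_s[OF i] add(1,2)]
      divided_difference.dd_add[OF divided_difference_sbar[OF i] add(1,2)]
    by (simp add: poly_y_add distrib_left distrib_right sum.distrib)
  with eqv_add[OF add(3,4)] show ?case
    by (simp add: poly_y_add distrib_left distrib_right ac_simps)
next
  case (pvar l f)
  have "gen_xi i * poly_y n (pvar l * f) \<sim> gen_xi i * (gen_y l * poly_y n f)"
    using i pvar by (intro eqv_mult_left poly_y_pvar_mult) auto
  also have "\<dots> = (gen_xi i * gen_y l) * poly_y n f"
    by (simp only: mult.assoc)
  also have "\<dots> \<sim> (gen_y l * gen_xi i + dunkl_pvar i l) * poly_y n f"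
    using i pvar by (intro eqv_mult_right xi_y) auto
  also have "\<dots> = gen_y l * (gen_xi i * poly_y n f) + dunkl_pvar i l * poly_y n f"
    by (simp only: distrib_right mult.assoc)
  also have "\<dots> \<sim> gen_y l * (poly_y n f * gen_xi i + dunkl i f) + dunkl_pvar i l * poly_y n f"
    using i pvar by (intro eqv_add eqv_mult_left eqv_refl) auto
  also have "\<dots> = (gen_y l * poly_y n f) * gen_xi i + (gen_y l * dunkl i f + dunkl_pvar i l * poly_y n f)"
    by (simp only: distrib_left mult.assoc add.assoc)
  also have "\<dots> \<sim> poly_y n (pvar l * f) * gen_xi i + dunkl i (pvar l * f)"
    using i pvar
    by (intro eqv_add eqv_mult_right eqv_sym[OF poly_y_pvar_mult] eqv_sym[OF dunkl_pvar_mult]) auto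
  finally show ?case .
qed

end

section \<open>Dunkl operators\<close>

theorem proposition6p6:
  fixes n i :: nat and u :: complex
    and V :: "(falg set, 'v) module" and \<beta> :: "falg set \<Rightarrow> 'v \<Rightarrow> 'v"
    and f :: mpoly and v :: 'v
  defines "M \<equiv> V_xi n u V \<beta>"
    and "tens \<equiv> poly_tensor n u V \<beta>"
  assumes "n \<ge> 4"
    and "left_module (spinW n) V"
    and "extends_by_zero n u V \<beta>"
    and "i \<in> {1..n}"
    and "f \<in> polys n"
    and "v \<in> carrier V"
  shows "inH n u (gen_xi i) \<odot>\<^bsub>M\<^esub> tens f v =
    (inH n u (scalar u) \<odot>\<^bsub>M\<^esub>
      (\<Oplus>\<^bsub>M\<^esub> k \<in> {1..n} - {i}.
        tens (pquot (f - psubst (refl_s k i) f) (pvar i - pvar k)) (inW n (brack k i) \<odot>\<^bsub>V\<^esub> v)))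
    \<ominus>\<^bsub>M\<^esub>
    (inH n u (scalar u) \<odot>\<^bsub>M\<^esub>
      (\<Oplus>\<^bsub>M\<^esub> k \<in> {1..n} - {i}.
        tens (pquot (f - psubst (refl_sbar k i) f) (pvar i + pvar k)) (inW n (brackbar n k i) \<odot>\<^bsub>V\<^esub> v)))"
proof -
  interpret hecke n u
    by unfold_locales (use assms(3) in simp)
  let ?V = "V\<lparr>smult := \<beta>\<rparr>" and ?S = "carrier (free_alg (spinW_gens n))"
  have \<beta>_mod: "left_module (h_xi n u) ?V"
    and \<beta>_spin: "\<And>p. p \<in> ?S \<Longrightarrow> \<beta> (inH n u p) v = inW n p \<odot>\<^bsub>V\<^esub> v"
    and \<beta>_xi: "\<beta> (inH n u (gen_xi i)) v = \<zero>\<^bsub>V\<^esub>"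
    using assms(5,6,8) unfolding extends_by_zero_def by auto
  let ?G = "(\<lambda>i. inH n u (gen_xi i)) ` {1..n} \<union> inH n u ` ?S"
  have carrier_h: "carrier (h_xi n u) = generate_ring (daha n u) ?G"
    by (simp add: h_xi_def)
  have inH [simp]: "inH n u p \<in> carrier (daha n u)" if "p \<in> H" for p
    using that by (simp add: inH_def daha_def)
  interpret induced "daha n u" "h_xi n u" ?V
  proof (rule induced.intro)
    show "ring (daha n u)"
      unfolding daha_def by (rule quot.ring_axioms)
    then show "carrier (h_xi n u) \<subseteq> carrier (daha n u)"
      unfolding carrier_h by (intro ring.generate_ring_incl) (auto simp: spin_H)
    show "abelian_group ?V"
      using \<beta>_mod by (rule left_module.axioms)
    show "b \<odot>\<^bsub>?V\<^esub> x \<in> carrier ?V" if "b \<in> carrier (h_xi n u)" "x \<in> carrier ?V" for b x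
      using left_module.smult_closed[OF \<beta>_mod that] .
  qed
  have M: "M = ind_module (daha n u) (h_xi n u) ?V"
    by (simp add: M_def V_xi_def)
  interpret M': abelian_group M
    unfolding M by (rule abelian_group_ind)
  have inH_add: "inH n u (p + q) = inH n u p \<oplus>\<^bsub>daha n u\<^esub> inH n u q" if "p \<in> H" "q \<in> H" for p q
    using that unfolding inH_def daha_def by (rule pclass_add)
  have inH_mult: "inH n u (p * q) = inH n u p \<otimes>\<^bsub>daha n u\<^esub> inH n u q" if "p \<in> H" "q \<in> H" for p q
    using that unfolding inH_def daha_def by (rule pclass_mult)
  \<comment> \<open>The map from p to p \<otimes> v is additive and compatible with left
    multiplication, so the claim becomes the image of one congruence in H.\<close>
  define \<Theta> where "\<Theta> p = tensor (inH n u p) v" for p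
  have v: "v \<in> carrier ?V"
    using assms(8) by simp
  have \<Theta>_closed [simp]: "\<Theta> p \<in> carrier M" if "p \<in> H" for p
    unfolding M \<Theta>_def using that v by (intro tensor_closed inH)
  have \<Theta>_add: "\<Theta> (p + q) = \<Theta> p \<oplus>\<^bsub>M\<^esub> \<Theta> q" if "p \<in> H" "q \<in> H" for p q
    unfolding M \<Theta>_def using that v by (simp only: inH_add tensor_add_left inH)
  have \<Theta>_0: "\<Theta> 0 = \<zero>\<^bsub>M\<^esub>"
    using \<Theta>_add[of 0 0] \<Theta>_closed[of 0] by (metis M'.add.r_cancel_one add_0 free_alg_0)
  have \<Theta>_sum: "\<Theta> (sum p K) = (\<Oplus>\<^bsub>M\<^esub>k\<in>K. \<Theta> (p k))" if "finite K" "\<And>k. k \<in> K \<Longrightarrow> p k \<in> H" for p and K :: "nat set"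
    using that by (induction K rule: finite_induct) (simp_all add: \<Theta>_0 \<Theta>_add)
  have \<Theta>_diff: "\<Theta> (p - q) = \<Theta> p \<ominus>\<^bsub>M\<^esub> \<Theta> q" if "p \<in> H" "q \<in> H" for p q
    using \<Theta>_add[of "p - q" q] that by (simp add: M'.minus_eq M'.add.m_assoc M'.r_neg)
  have \<Theta>_smult: "inH n u p \<odot>\<^bsub>M\<^esub> \<Theta> q = \<Theta> (p * q)" if "p \<in> H" "q \<in> H" for p q
    unfolding M \<Theta>_def using that v by (simp only: smult_tensor inH_mult inH)
  have tens: "tens g w = tensor (inH n u (poly_y n g)) w" for g w
    by (simp add: tens_def poly_tensor_def)
  \<comment> \<open>Elements of the spin Weyl group algebra lie in \<open>h_xi\<close>, so they may
    cross the tensor sign, where \<open>\<beta>\<close> restricts to the given action on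
    \<open>V\<close>.\<close>
  have \<Theta>_spin: "tens g (inW n p \<odot>\<^bsub>V\<^esub> v) = \<Theta> (poly_y n g * p)" if "p \<in> ?S" for g p
  proof -
    have "inH n u p \<in> carrier (h_xi n u)"
      unfolding carrier_h using that by (intro generate_ring.incl) simp
    then show ?thesis
      using tensor_balanced[of "inH n u (poly_y n g)" "inH n u p" v] that v
      by (simp add: tens \<Theta>_def \<beta>_spin inH_mult spin_H)
  qed
  \<comment> \<open>Here xi_i crosses the tensor sign and annihilates \<open>v\<close>.\<close>
  have \<Theta>_xi: "\<Theta> (poly_y n f * gen_xi i) = \<zero>\<^bsub>M\<^esub>"
  proof -
    have "inH n u (gen_xi i) \<in> carrier (h_xi n u)"
      unfolding carrier_h using assms(6) by (intro generate_ring.incl) simp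
    then show ?thesis
      using tensor_balanced[of "inH n u (poly_y n f)" "inH n u (gen_xi i)" v]
        tensor_zero[of "inH n u (poly_y n f)"] assms(6) v
      by (simp add: \<Theta>_def \<beta>_xi inH_mult M)
  qed
  have "inH n u (gen_xi i) \<odot>\<^bsub>M\<^esub> tens f v = \<Theta> (gen_xi i * poly_y n f)"
    using \<Theta>_smult[of "gen_xi i" "poly_y n f"] assms(6) by (simp add: tens \<Theta>_def)
  \<comment> \<open>Congruent elements have the same class in H, so the commutation formula becomes
    an equality of tensors.\<close>
  also have "\<dots> = \<Theta> (poly_y n f * gen_xi i + dunkl i f)"
    using pclass_eqI[OF xi_poly_y[OF assms(6,7)]] by (simp add: \<Theta>_def inH_def)
  also have "\<dots> = \<Theta> (dunkl i f)"
    using assms(6) by (simp add: \<Theta>_add \<Theta>_xi)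
  also have "\<dots> =
    (inH n u (scalar u) \<odot>\<^bsub>M\<^esub> (\<Oplus>\<^bsub>M\<^esub>k\<in>{1..n} - {i}. \<Theta> (poly_y n (quot_s i k f) * brack k i))) \<ominus>\<^bsub>M\<^esub>
    (inH n u (scalar u) \<odot>\<^bsub>M\<^esub> (\<Oplus>\<^bsub>M\<^esub>k\<in>{1..n} - {i}. \<Theta> (poly_y n (quot_sbar i k f) * brackbar n k i)))"
  proof -
    let ?K = "{1..n} - {i}"
    let ?p = "\<lambda>k. poly_y n (quot_s i k f) * brack k i"
    let ?q = "\<lambda>k. poly_y n (quot_sbar i k f) * brackbar n k i"
    have H: "?p k \<in> H" "?q k \<in> H" if "k \<in> ?K" for k
      using that assms(6) by (auto intro!: free_alg_mult H_brackets)
    have "sum ?p ?K \<in> H" "sum ?q ?K \<in> H"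
      by (intro free_alg_sum H; assumption)+
    moreover have "(\<Oplus>\<^bsub>M\<^esub>k\<in>?K. \<Theta> (?p k)) = \<Theta> (sum ?p ?K)" "(\<Oplus>\<^bsub>M\<^esub>k\<in>?K. \<Theta> (?q k)) = \<Theta> (sum ?q ?K)"
      by (intro \<Theta>_sum[symmetric] H; simp)+
    ultimately show ?thesis
      by (simp only: dunkl_def \<Theta>_smult \<Theta>_diff H_gens free_alg_mult)
  qed
  also have "(\<Oplus>\<^bsub>M\<^esub>k\<in>{1..n} - {i}. \<Theta> (poly_y n (quot_s i k f) * brack k i)) =
      (\<Oplus>\<^bsub>M\<^esub>k\<in>{1..n} - {i}. tens (quot_s i k f) (inW n (brack k i) \<odot>\<^bsub>V\<^esub> v))"
    using assms(6) by (intro M'.finsum_cong') (auto simp: \<Theta>_spin intro!: \<Theta>_closed free_alg_mult)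
  also have "(\<Oplus>\<^bsub>M\<^esub>k\<in>{1..n} - {i}. \<Theta> (poly_y n (quot_sbar i k f) * brackbar n k i)) =
      (\<Oplus>\<^bsub>M\<^esub>k\<in>{1..n} - {i}. tens (quot_sbar i k f) (inW n (brackbar n k i) \<odot>\<^bsub>V\<^esub> v))"
    using assms(6) by (intro M'.finsum_cong') (auto simp: \<Theta>_spin intro!: \<Theta>_closed free_alg_mult)
  finally show ?thesis
    unfolding divdiff_def .
qed

end
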